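(* Let $k:\mathbb{R}^d\times\mathbb{R}^d\to\mathbb{R}$ be given by $k(\mathbf{x},\mathbf{y})=\psi(\mathbf{x}-\mathbf{y})$, where $\psi:\mathbb{R}^d\to\mathbb{R}$ is bounded, continuous and positive definite with $\psi(0)=1$, and let $\Lambda$ be the associated Borel probability measure on $\mathbb{R}^d$. Suppose $\sigma^2:=\int_{\mathbb{R}^d}\|\boldsymbol{\omega}\|_2^2\,d\Lambda(\boldsymbol{\omega})<\infty$. Let $m\ge 1$ and let $\hat k$ be the random Fourier feature approximation of $k$ built from $(\boldsymbol{\omega}_i)_{i=1}^m$ drawn i.i.d. from $\Lambda$. Then for any $\tau>0$ and any non-empty compact set $S\subset\mathbb{R}^d$, $$\Lambda^m\left(\left\{(\boldsymbol{\omega}_i)_{i=1}^m:\ \|\hat k-k\|_{S\times S}\ \ge\ \frac{h(d,|S|,\sigma)+\sqrt{2\tau}}{\sqrt m}\right\}\right)\le e^{-\tau},$$ where $$h(d,|S|,\sigma):=32\sqrt{2d\log(2|S|+1)}+32\sqrt{2d\log(\sigma+1)}+16\sqrt{2d\,[\log(2|S|+1)]^{-1}}.$$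
   Context: Here $d\ge 1$, and $\log$ is the natural logarithm. By Bochner's theorem, a bounded continuous positive definite $\psi:\mathbb{R}^d\to\mathbb{R}$ with $\psi(0)=1$ is the Fourier transform of a unique Borel probability measure $\Lambda$ on $\mathbb{R}^d$: $\psi(\mathbf{z})=\int e^{\sqrt{-1}\,\boldsymbol{\omega}^T\mathbf{z}}\,d\Lambda(\boldsymbol{\omega})=\int\cos(\boldsymbol{\omega}^T\mathbf{z})\,d\Lambda(\boldsymbol{\omega})$. Given $\boldsymbol{\omega}_1,\dots,\boldsymbol{\omega}_m\in\mathbb{R}^d$, the random Fourier feature approximation is $\hat k(\mathbf{x},\mathbf{y})=\frac1m\sum_{i=1}^m\cos(\boldsymbol{\omega}_i^T(\mathbf{x}-\mathbf{y}))$. $\Lambda^m$ is the $m$-fold product measure, $\sigma\ge 0$ is the square root of $\sigma^2$, $|S|=\sup\{\|\mathbf{x}-\mathbf{y}\|_2:\mathbf{x},\mathbf{y}\in S\}$ is the Euclidean diameter, and $\|f\|_{S\times S}=\sup_{\mathbf{x},\mathbf{y}\in S}|f(\mathbf{x},\mathbf{y})|$. If $|S|=0$, then $[\log(2|S|+1)]^{-1}$ is read as $+\infty$, so $h=+\infty$. *)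

theory Defs
  imports "HOL-Probability.Probability"
begin

text \<open>
  Complex coefficients are used, as in Bochner's theorem; for a real-valued function this
  forces \<open>\<psi>\<close> to be even, which positivity for real coefficients alone would not.
\<close>

definition positive_definite :: "('a::real_vector \<Rightarrow> real) \<Rightarrow> bool" where
  "positive_definite \<psi> \<longleftrightarrow>
    (\<forall>(n::nat) (x :: nat \<Rightarrow> 'a) (c :: nat \<Rightarrow> complex).
      (\<Sum>i<n. \<Sum>j<n. c i * cnj (c j) * complex_of_real (\<psi> (x i - x j))) \<in> \<real>\<^sub>\<ge>\<^sub>0)"

definition is_spectral_measure :: "('a::euclidean_space) measure \<Rightarrow> ('a \<Rightarrow> real) \<Rightarrow> bool" where
  "is_spectral_measure \<Lambda> \<psi> \<longleftrightarrow>
    prob_space \<Lambda> \<and> sets \<Lambda> = sets borel \<and>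
    (\<forall>z. complex_of_real (\<psi> z) = (CLINT \<omega>|\<Lambda>. exp (\<i> * complex_of_real (\<omega> \<bullet> z))))"

definition rff_kernel :: "nat \<Rightarrow> (nat \<Rightarrow> 'a::real_inner) \<Rightarrow> 'a \<Rightarrow> 'a \<Rightarrow> real" where
  "rff_kernel m \<omega> x y = (1 / real m) * (\<Sum>i<m. cos (\<omega> i \<bullet> (x - y)))"

text \<open>
  This is a supremum of reals, so it is meaningful only for \<open>S\<close> non-empty and \<open>f\<close>
  bounded on \<open>S \<times> S\<close>.
\<close>

definition sup_norm_on :: "'a set \<Rightarrow> ('a \<Rightarrow> 'a \<Rightarrow> real) \<Rightarrow> real" where
  "sup_norm_on S f = (SUP (x, y)\<in>S \<times> S. \<bar>f x y\<bar>)"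

definition spectral_sigma :: "('a::euclidean_space) measure \<Rightarrow> real" where
  "spectral_sigma \<Lambda> = sqrt (LINT \<omega>|\<Lambda>. (norm \<omega>)\<^sup>2)"

text \<open>
  For diameter \<open>D = 0\<close> the inverse logarithm is read as \<open>+\<infinity>\<close> (and not as \<open>1 / 0 = 0\<close>),
  which is why the value is an extended real.
\<close>

definition rff_h :: "nat \<Rightarrow> real \<Rightarrow> real \<Rightarrow> ereal" where
  "rff_h d D \<sigma> =
    (if D = 0 then \<infinity>
     else ereal (32 * sqrt (2 * real d * ln (2 * D + 1))
               + 32 * sqrt (2 * real d * ln (\<sigma> + 1))
               + 16 * sqrt (2 * real d * inverse (ln (2 * D + 1)))))"

end

theory Submission
  imports Defs
begin

text \<open>
  Changing one frequency moves the uniform error by at most \<open>2 / m\<close>, so McDiarmid's inequality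
  yields exactly the term \<open>sqrt (2 * \<tau> / m)\<close>, and it remains to bound the expected
  uniform error by \<open>h / sqrt m\<close>.

  This is done by chaining over deterministic nets of the ball of radius \<open>D\<close> (the diameter) at
  scales \<open>2\<^sup>-\<^sup>j / (\<sigma> + 1)\<close>, whose cardinalities are bounded by comparing volumes. The increments
  \<open>cos (w \<bullet> z) - cos (w \<bullet> u)\<close> are dominated by \<open>norm w * norm (z - u)\<close>, which is only square
  integrable; instead of symmetrization, each link of the chain uses the self-normalized
  exponential bound coming from \<open>exp (x - x\<^sup>2 / 2) \<le> 1 + x + x\<^sup>2 / 2\<close>, valid for all real \<open>x\<close>.
\<close>

section \<open>Preliminaries: an exponential inequality, coordinates of product measures, and nets
  of balls\<close>

text \<open>After taking logarithms, the difference
  \<open>ln (1 + x + x^2 / 2) + x^2 / 2 - x\<close> vanishes at 0 and its derivative has the sign of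
  its argument, so 0 is its minimum.\<close>

lemma exp_minus_half_square_le:
  fixes x :: real
  shows "exp (x - x\<^sup>2 / 2) \<le> 1 + x + x\<^sup>2 / 2"
proof -
  let ?q = "\<lambda>x::real. 1 + x + x\<^sup>2 / 2"
  let ?g = "\<lambda>x::real. ln (?q x) + x\<^sup>2 / 2 - x"
  have q: "?q t > 0" for t :: real
  proof -
    have "?q t = ((1 + t)\<^sup>2 + 1) / 2"
      by (simp add: power2_eq_square field_simps)
    also have "\<dots> > 0"
      by (intro divide_pos_pos add_nonneg_pos) auto
    finally show ?thesis .
  qed
  have deriv: "(?g has_real_derivative (t * (1 + t / 2 + t\<^sup>2 / 2) / ?q t)) (at t)" for t
    using q[of t] by (auto intro!: derivative_eq_intros simp: divide_simps) algebra
  have pos: "1 + t / 2 + t\<^sup>2 / 2 > 0" for t :: real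
  proof -
    have "1 + t / 2 + t\<^sup>2 / 2 = ((t + 1 / 2)\<^sup>2 + 7 / 4) / 2"
      by (simp add: power2_eq_square field_simps)
    also have "\<dots> > 0"
      by (intro divide_pos_pos add_nonneg_pos) auto
    finally show ?thesis .
  qed
  have "?g 0 \<le> ?g x"
  proof (cases "x \<ge> 0")
    case True
    show ?thesis
      by (rule DERIV_nonneg_imp_nondecreasing[OF True])
        (intro exI conjI, rule deriv,
         intro divide_nonneg_pos mult_nonneg_nonneg q less_imp_le[OF pos], simp)
  next
    case False
    then have "x \<le> 0" by simp
    then show ?thesis
      by (rule DERIV_nonpos_imp_nonincreasing)
        (intro exI conjI, rule deriv,
         intro divide_nonpos_pos mult_nonpos_nonneg q less_imp_le[OF pos], simp)
  qed
  then have "x - x\<^sup>2 / 2 \<le> ln (?q x)" by simp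
  then show ?thesis
    using q[of x] by (metis exp_le_cancel_iff exp_ln)
qed

lemma integral_PiM_component:
  fixes f :: "'b \<Rightarrow> real"
  assumes "prob_space N" "i \<in> I" and [measurable]: "f \<in> borel_measurable N"
  shows "(\<integral>\<omega>. f (\<omega> i) \<partial>Pi\<^sub>M I (\<lambda>_. N)) = (\<integral>x. f x \<partial>N)"
    and "integrable N f \<Longrightarrow> integrable (Pi\<^sub>M I (\<lambda>_. N)) (\<lambda>\<omega>. f (\<omega> i))"
proof -
  have d: "distr (Pi\<^sub>M I (\<lambda>_. N)) N (\<lambda>\<omega>. \<omega> i) = N"
    using distr_PiM_component[of I "\<lambda>_. N" i] assms by simp
  have [measurable]: "(\<lambda>\<omega>. \<omega> i) \<in> Pi\<^sub>M I (\<lambda>_. N) \<rightarrow>\<^sub>M N"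
    using assms(2) by (rule measurable_component_singleton)
  show "(\<integral>\<omega>. f (\<omega> i) \<partial>Pi\<^sub>M I (\<lambda>_. N)) = (\<integral>x. f x \<partial>N)"
    by (subst d[symmetric], subst integral_distr) auto
  show "integrable (Pi\<^sub>M I (\<lambda>_. N)) (\<lambda>\<omega>. f (\<omega> i))" if "integrable N f"
    using that by (subst (asm) d[symmetric], subst (asm) integrable_distr_eq) auto
qed

text \<open>Balls of radius \<open>\<delta> / 2\<close> around points with mutual distances above
  \<open>\<delta>\<close> are disjoint and lie in the ball of radius
  \<open>D + \<delta> / 2\<close>. Comparing volumes bounds the size of every such separated set, so
  one of maximal size exists. Keeping 0 in the set makes the nets non-empty and later gives the
  maxima over them a sign.\<close>

lemma finite_net_cball:
  fixes D \<delta> :: real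
  assumes "D \<ge> 0" "\<delta> > 0"
  obtains T :: "'a::euclidean_space set"
    where "finite T" "0 \<in> T" "T \<subseteq> cball 0 D" "\<And>z. z \<in> cball 0 D \<Longrightarrow> \<exists>u\<in>T. dist z u \<le> \<delta>"
      "real (card T) \<le> (1 + 2 * D / \<delta>) ^ DIM('a)"
proof -
  define sep where "sep = (\<lambda>T::'a set. finite T \<and> 0 \<in> T \<and> T \<subseteq> cball 0 D \<and>
    (\<forall>u\<in>T. \<forall>v\<in>T. u \<noteq> v \<longrightarrow> dist u v > \<delta>))"
  have card_le: "real (card T) \<le> (1 + 2 * D / \<delta>) ^ DIM('a)" if "sep T" for T
  proof -
    have fin: "finite T" using that by (auto simp: sep_def)
    let ?v = "unit_ball_vol (real DIM('a))"
    have vpos: "?v > 0" by (simp add: unit_ball_vol_def)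
    have disj: "disjoint_family_on (\<lambda>u. ball u (\<delta>/2)) T"
    proof (unfold disjoint_family_on_def, intro ballI impI)
      fix u v assume "u \<in> T" "v \<in> T" "u \<noteq> v"
      then have "dist u v > \<delta>" using that by (auto simp: sep_def)
      then show "ball u (\<delta>/2) \<inter> ball v (\<delta>/2) = {}"
        by (intro disjoint_ballI) simp
    qed
    have sub: "(\<Union>u\<in>T. ball u (\<delta>/2)) \<subseteq> ball 0 (D + \<delta>/2)"
    proof
      fix x assume "x \<in> (\<Union>u\<in>T. ball u (\<delta>/2))"
      then obtain u where u: "u \<in> T" "dist u x < \<delta>/2" by auto
      then have "dist 0 u \<le> D" using that by (auto simp: sep_def)
      then show "x \<in> ball 0 (D + \<delta>/2)" using u dist_triangle[of 0 x u] by auto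
    qed
    have "(\<Sum>u\<in>T. measure lborel (ball u (\<delta>/2))) = measure lborel (\<Union>u\<in>T. ball u (\<delta>/2))"
      by (rule measure_finite_Union[symmetric])
        (use fin disj in \<open>auto simp: emeasure_ball \<open>\<delta> > 0\<close> less_imp_le\<close>)
    also have "\<dots> \<le> measure lborel (ball (0::'a) (D + \<delta>/2))"
      using sub by (intro measure_mono_fmeasurable) (auto intro!: fmeasurableI fin emeasure_lborel_ball_finite)
    finally have "real (card T) * (?v * (\<delta>/2) ^ DIM('a)) \<le> ?v * (D + \<delta>/2) ^ DIM('a)"
      using assms by (simp add: content_ball)
    then have "real (card T) * (\<delta>/2) ^ DIM('a) \<le> (D + \<delta>/2) ^ DIM('a)"
      using vpos by (simp add: mult.left_commute)
    then have "real (card T) \<le> (D + \<delta>/2) ^ DIM('a) / (\<delta>/2) ^ DIM('a)"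
      using assms by (simp add: pos_le_divide_eq)
    also have "\<dots> = (1 + 2 * D / \<delta>) ^ DIM('a)"
    proof -
      have "(D + \<delta>/2) / (\<delta>/2) = 1 + 2 * D / \<delta>"
        using assms by (simp add: field_simps)
      then show ?thesis by (simp flip: power_divide)
    qed
    finally show ?thesis .
  qed
  \<comment> \<open>A separated set of maximal cardinality is a net.\<close>
  have s0: "sep {0}" using assms by (auto simp: sep_def)
  obtain T where T: "sep T" and max: "\<And>T'. sep T' \<Longrightarrow> card T' \<le> card T"
  proof -
    have "card T < Suc (nat \<lfloor>(1 + 2 * D / \<delta>) ^ DIM('a)\<rfloor>)" if "sep T" for T
      using card_le[OF that] by (simp add: less_Suc_eq_le le_nat_floor)
    then show thesis
      using ex_has_greatest_nat[of sep "{0}" card "Suc (nat \<lfloor>(1 + 2 * D / \<delta>) ^ DIM('a)\<rfloor>)"] s0 that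
      by blast
  qed
  have cover: "\<exists>u\<in>T. dist z u \<le> \<delta>" if "z \<in> cball 0 D" for z
  proof (rule ccontr)
    assume neg: "\<not> (\<exists>u\<in>T. dist z u \<le> \<delta>)"
    then have "z \<notin> T" using assms by force
    moreover have "sep (insert z T)"
      using T that neg by (auto simp: sep_def dist_commute not_le)
    ultimately show False
      using max[of "insert z T"] T by (simp add: sep_def)
  qed
  show thesis
    using T cover card_le[OF T] by (intro that[of T]) (auto simp: sep_def)
qed

subsection \<open>McDiarmid's inequality\<close>

text \<open>Bounded differences control the oscillation of \<open>f\<close> without naming an
  interval. The values lie between the infimum of \<open>f\<close> and that infimum plus
  \<open>c\<close>, so Hoeffding's lemma for an interval of length \<open>c\<close> applies;
  \<open>K\<close> makes the infimum finite and the exponential integrable.\<close>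

lemma (in prob_space) Hoeffdings_lemma_diff:
  fixes f :: "'a \<Rightarrow> real"
  assumes "l > 0" and [measurable]: "f \<in> borel_measurable M"
    and diff: "\<And>x y. x \<in> space M \<Longrightarrow> y \<in> space M \<Longrightarrow> f x - f y \<le> c"
    and bdd: "\<And>x. x \<in> space M \<Longrightarrow> \<bar>f x\<bar> \<le> K"
  shows "expectation (\<lambda>x. exp (l * (f x - expectation f))) \<le> exp (l\<^sup>2 * c\<^sup>2 / 8)"
proof -
  let ?a = "INF y\<in>space M. f y"
  have bb: "bdd_below (f ` space M)"
    using bdd by (intro bdd_belowI2[where m = "- K"]) (force simp: abs_le_iff)
  have "?a \<le> f x" "f x \<le> ?a + c" if "x \<in> space M" for x
  proof -
    show "?a \<le> f x" using bb that by (rule cINF_lower)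
    have "f x - c \<le> ?a"
      using diff[OF that] not_empty by (intro cINF_greatest) (auto simp: algebra_simps)
    then show "f x \<le> ?a + c" by simp
  qed
  then interpret interval_bounded_random_variable M f ?a "?a + c"
    by unfold_locales auto
  have int: "integrable M (\<lambda>x. exp (l * (f x - expectation f)))"
  proof (rule integrable_const_bound)
    show "AE x in M. norm (exp (l * (f x - expectation f))) \<le> exp (l * (K - expectation f))"
      using bdd \<open>l > 0\<close> by (intro AE_I2) (auto simp: abs_le_iff)
  qed simp
  have "ennreal (expectation (\<lambda>x. exp (l * (f x - expectation f))))
      = (\<integral>\<^sup>+x. exp (l * (f x - expectation f)) \<partial>M)"
    using int by (intro nn_integral_eq_integral[symmetric]) auto
  also have "\<dots> \<le> ennreal (exp (l\<^sup>2 * c\<^sup>2 / 8))"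
    using Hoeffdings_lemma_nn_integral[OF \<open>l > 0\<close>] by simp
  finally show ?thesis by (simp add: ennreal_le_iff)
qed

text \<open>Induction on the number of coordinates, integrating out the last one. The average
  \<open>G\<close> of \<open>F\<close> over that coordinate inherits the bound \<open>K\<close> and
  the differences \<open>c\<close>. With the other coordinates fixed, \<open>F - G\<close> is
  centred and oscillates by at most \<open>c\<close>, so Hoeffding's lemma contributes one factor
  \<open>exp (l^2 * c^2 / 8)\<close>.\<close>

lemma mcdiarmid_mgf:
  fixes F :: "(nat \<Rightarrow> 'a) \<Rightarrow> real" and l :: real
  assumes N: "prob_space N" and "l > 0"
    and F: "F \<in> borel_measurable (Pi\<^sub>M {..<n} (\<lambda>_. N))"
    and bdd: "\<And>\<omega>. \<omega> \<in> space (Pi\<^sub>M {..<n} (\<lambda>_. N)) \<Longrightarrow> \<bar>F \<omega>\<bar> \<le> K"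
    and diff: "\<And>x i y. x \<in> space (Pi\<^sub>M {..<n} (\<lambda>_. N)) \<Longrightarrow> i < n \<Longrightarrow> y \<in> space N \<Longrightarrow>
      \<bar>F (x(i := y)) - F x\<bar> \<le> c"
  shows "(\<integral>\<omega>. exp (l * (F \<omega> - (\<integral>\<omega>. F \<omega> \<partial>Pi\<^sub>M {..<n} (\<lambda>_. N)))) \<partial>Pi\<^sub>M {..<n} (\<lambda>_. N))
    \<le> exp (real n * (l\<^sup>2 * c\<^sup>2 / 8))"
  using F bdd diff
proof (induction n arbitrary: F)
  case 0
  show ?case by (simp add: PiM_empty lebesgue_integral_count_space_finite)
next
  case (Suc n)
  interpret N: prob_space N by fact
  interpret PN: product_prob_space "\<lambda>_::nat. N" by unfold_locales
  let ?P = "Pi\<^sub>M {..<n} (\<lambda>_. N)" and ?P' = "Pi\<^sub>M {..<Suc n} (\<lambda>_. N)"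
  interpret P: prob_space ?P by (rule prob_space_PiM) (rule N)
  interpret P': prob_space ?P' by (rule prob_space_PiM) (rule N)
  have ins: "{..<Suc n} = insert n {..<n}" by auto
  note [measurable] = Suc.prems(1)
  have [measurable]: "F \<in> borel_measurable (Pi\<^sub>M (insert n {..<n}) (\<lambda>_. N))"
    using Suc.prems(1) by (simp add: ins)
  have [measurable]: "(\<lambda>p. (fst p)(n := snd p)) \<in> ?P \<Otimes>\<^sub>M N \<rightarrow>\<^sub>M Pi\<^sub>M (insert n {..<n}) (\<lambda>_. N)"
    using measurable_add_dim[of n "{..<n}" "\<lambda>_. N"] by (simp add: case_prod_beta')
  have upd: "x(n := y) \<in> space ?P'" if "x \<in> space ?P" "y \<in> space N" for x y
    using that by (auto simp: space_PiM PiE_iff extensional_def less_Suc_eq)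
  define G where "G x = (\<integral>y. F (x(n := y)) \<partial>N)" for x
  have [measurable]: "(\<lambda>p. F ((fst p)(n := snd p))) \<in> borel_measurable (?P \<Otimes>\<^sub>M N)"
    by measurable
  have G [measurable]: "G \<in> borel_measurable ?P"
    unfolding G_def by (rule N.borel_measurable_lebesgue_integral) (simp add: case_prod_beta')
  have slice [measurable]: "(\<lambda>y. F (x(n := y))) \<in> borel_measurable N" if "x \<in> space ?P" for x
    using measurable_compose[OF measurable_component_update[OF that] \<open>F \<in> borel_measurable (Pi\<^sub>M (insert n {..<n}) (\<lambda>_. N))\<close>]
    by simp
  have slice_int: "integrable N (\<lambda>y. F (x(n := y)))" if "x \<in> space ?P" for x
    using slice[OF that] by (intro N.integrable_const_bound[where B = K] AE_I2)
      (simp_all only: real_norm_def Suc.prems(2)[OF upd[OF that]])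
  have G_bdd: "\<bar>G x\<bar> \<le> K" if x: "x \<in> space ?P" for x
  proof -
    have "- K \<le> F (x(n := y))" "F (x(n := y)) \<le> K" if "y \<in> space N" for y
      using Suc.prems(2)[OF upd[OF x that]] by linarith+
    then have "- K \<le> G x" "G x \<le> K"
      unfolding G_def using slice_int[OF x]
      by (auto intro!: N.integral_ge_const N.integral_le_const)
    then show ?thesis by simp
  qed
  have G_diff: "\<bar>G (x(i := z)) - G x\<bar> \<le> c" if x: "x \<in> space ?P" and i: "i < n" and z: "z \<in> space N" for x i z
  proof -
    have x': "x(i := z) \<in> space ?P"
      using x i z by (auto simp: space_PiM PiE_iff extensional_def)
    have eq: "G (x(i := z)) - G x = (\<integral>y. F (x(i := z, n := y)) - F (x(n := y)) \<partial>N)"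
      unfolding G_def using slice_int x x' by simp
    have le: "\<bar>F (x(i := z, n := y)) - F (x(n := y))\<bar> \<le> c" if "y \<in> space N" for y
    proof -
      \<comment> \<open>Swapping the updates turns the change of \<open>x\<close> before averaging
        into a change of one coordinate of an argument of \<open>F\<close>, to which the hypothesis
        on differences applies.\<close>
      have "x(i := z, n := y) = x(n := y, i := z)"
        by (rule fun_upd_twist) (use i in simp)
      then show ?thesis
        using Suc.prems(3)[OF upd[OF x that] less_SucI[OF i] z] by metis
    qed
    have "- c \<le> F (x(i := z, n := y)) - F (x(n := y))"
      "F (x(i := z, n := y)) - F (x(n := y)) \<le> c" if "y \<in> space N" for y
      using le[OF that] by linarith+
    then have "- c \<le> G (x(i := z)) - G x" "G (x(i := z)) - G x \<le> c"
      unfolding eq using slice_int[OF x] slice_int[OF x']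
      by (intro N.integral_ge_const N.integral_le_const Bochner_Integration.integrable_diff AE_I2; simp)+
    then show ?thesis by simp
  qed
  define E where "E = (\<integral>\<omega>. F \<omega> \<partial>?P')"
  have intF: "integrable ?P' F"
    using Suc.prems(2) by (intro P'.integrable_const_bound[where B = K]) auto
  have EG: "E = (\<integral>x. G x \<partial>?P)"
    using intF unfolding E_def G_def ins by (subst PN.product_integral_insert) auto
  have intexp: "integrable ?P' (\<lambda>\<omega>. exp (l * (F \<omega> - E)))"
    using Suc.prems(2) \<open>l > 0\<close>
    by (intro P'.integrable_const_bound[where B = "exp (l * (K - E))"])
      (auto simp: abs_le_iff)
  have "(\<integral>\<omega>. exp (l * (F \<omega> - E)) \<partial>?P') = (\<integral>x. (\<integral>y. exp (l * (F (x(n := y)) - E)) \<partial>N) \<partial>?P)"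
    using intexp unfolding ins by (subst PN.product_integral_insert) auto
  also have "\<dots> \<le> (\<integral>x. exp (l * (G x - E)) * exp (l\<^sup>2 * c\<^sup>2 / 8) \<partial>?P)"
  proof (rule integral_mono')
    show "integrable ?P (\<lambda>x. exp (l * (G x - E)) * exp (l\<^sup>2 * c\<^sup>2 / 8))"
      using G_bdd \<open>l > 0\<close>
      by (intro integrable_mult_left P.integrable_const_bound[where B = "exp (l * (K - E))"])
        (auto simp: abs_le_iff)
    fix x assume x: "x \<in> space ?P"
    have "(\<integral>y. exp (l * (F (x(n := y)) - E)) \<partial>N)
        = (\<integral>y. exp (l * (G x - E)) * exp (l * (F (x(n := y)) - G x)) \<partial>N)"
      by (intro Bochner_Integration.integral_cong refl)
        (simp add: exp_add[symmetric] algebra_simps)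
    also have "\<dots> = exp (l * (G x - E)) * (\<integral>y. exp (l * (F (x(n := y)) - G x)) \<partial>N)"
      by simp
    also have "(\<integral>y. exp (l * (F (x(n := y)) - G x)) \<partial>N) \<le> exp (l\<^sup>2 * c\<^sup>2 / 8)"
      unfolding G_def
    proof (rule N.Hoeffdings_lemma_diff[OF \<open>l > 0\<close> slice[OF x]])
      fix y z assume y: "y \<in> space N" and z: "z \<in> space N"
      show "F (x(n := y)) - F (x(n := z)) \<le> c"
        using Suc.prems(3)[OF upd[OF x z] lessI y] unfolding fun_upd_upd by linarith
      show "\<bar>F (x(n := y))\<bar> \<le> K" by (rule Suc.prems(2)[OF upd[OF x y]])
    qed
    finally show "(\<integral>y. exp (l * (F (x(n := y)) - E)) \<partial>N) \<le> exp (l * (G x - E)) * exp (l\<^sup>2 * c\<^sup>2 / 8)"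
      by simp
  qed simp
  also have "\<dots> = (\<integral>x. exp (l * (G x - E)) \<partial>?P) * exp (l\<^sup>2 * c\<^sup>2 / 8)"
    by simp
  also have "\<dots> \<le> exp (real n * (l\<^sup>2 * c\<^sup>2 / 8)) * exp (l\<^sup>2 * c\<^sup>2 / 8)"
    unfolding EG by (intro mult_right_mono Suc.IH G G_bdd G_diff) auto
  also have "\<dots> = exp (real (Suc n) * (l\<^sup>2 * c\<^sup>2 / 8))"
    by (simp add: exp_add[symmetric] algebra_simps)
  finally show ?case unfolding E_def .
qed

text \<open>Chernoff's bound applied to the exponential moment estimate, with the parameter
  optimized.\<close>

lemma mcdiarmid:
  fixes F :: "(nat \<Rightarrow> 'a) \<Rightarrow> real" and N :: "'a measure" and n :: nat
  defines "P \<equiv> Pi\<^sub>M {..<n} (\<lambda>_. N)"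
  assumes N: "prob_space N" and "n > 0" "c > 0" "s > 0"
    and F [measurable]: "F \<in> borel_measurable P"
    and bdd: "\<And>\<omega>. \<omega> \<in> space P \<Longrightarrow> \<bar>F \<omega>\<bar> \<le> K"
    and diff: "\<And>x i y. x \<in> space P \<Longrightarrow> i < n \<Longrightarrow> y \<in> space N \<Longrightarrow>
      \<bar>F (x(i := y)) - F x\<bar> \<le> c"
  shows "measure P {\<omega> \<in> space P. F \<omega> \<ge> (\<integral>\<omega>. F \<omega> \<partial>P) + s}
    \<le> exp (- 2 * s\<^sup>2 / (real n * c\<^sup>2))"
proof -
  interpret P: prob_space P unfolding P_def by (rule prob_space_PiM) (rule N)
  define E where "E = (\<integral>\<omega>. F \<omega> \<partial>P)"
  \<comment> \<open>The minimizer of the Chernoff exponent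
    \<open>- l * s + real n * (l^2 * c^2 / 8)\<close>.\<close>
  define l where "l = 4 * s / (real n * c\<^sup>2)"
  have l: "l > 0" using assms by (simp add: l_def)
  have int: "integrable P (\<lambda>\<omega>. exp (l * (F \<omega> - E)))"
    using bdd l by (intro P.integrable_const_bound[where B = "exp (l * (K - E))"])
      (auto simp: abs_le_iff)
  have "P.prob {\<omega> \<in> space P. F \<omega> \<ge> E + s} = P.prob {\<omega> \<in> space P. F \<omega> - E \<ge> s}"
    by (simp add: algebra_simps)
  also have "\<dots> \<le> exp (- l * s) * (\<integral>\<omega>\<in>space P. exp (l * (F \<omega> - E)) \<partial>P)"
    using int by (intro P.Chernoff_ineq_ge l)
      (use integrable_mult_indicator[OF sets.top int] in \<open>simp_all add: set_integrable_def\<close>)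
  also have "\<dots> = exp (- l * s) * (\<integral>\<omega>. exp (l * (F \<omega> - E)) \<partial>P)"
    using int by (simp add: set_integral_space)
  also have "\<dots> \<le> exp (- l * s) * exp (real n * (l\<^sup>2 * c\<^sup>2 / 8))"
    unfolding E_def P_def using assms(6-8) N l unfolding P_def
    by (intro mult_left_mono mcdiarmid_mgf[where K = K]) auto
  also have "\<dots> = exp (- 2 * s\<^sup>2 / (real n * c\<^sup>2))"
    using assms(3,4) by (simp add: l_def exp_add[symmetric] field_simps power2_eq_square)
  finally show ?thesis unfolding E_def .
qed

subsection \<open>A self-normalized maximal inequality\<close>

text \<open>The subtracted square keeps each exponent at most 1/2, so the exponential moments are
  finite although \<open>X\<close> is only square integrable. By
  \<open>exp_minus_half_square_le\<close> and centring, one factor has mean at most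
  \<open>1 + l^2 * q / 2\<close>; independence multiplies the factors.\<close>

lemma self_normalized_mgf_le:
  fixes X :: "'a \<Rightarrow> real" and l :: real and m :: nat
  assumes N: "prob_space N" and [measurable]: "X \<in> borel_measurable N"
    and X: "integrable N X" "(\<integral>x. X x \<partial>N) = 0"
    and X2: "integrable N (\<lambda>x. (X x)\<^sup>2)" "(\<integral>x. (X x)\<^sup>2 \<partial>N) \<le> q"
  defines "Z \<equiv> \<lambda>\<omega>. exp (\<Sum>i<m. l * X (\<omega> i) - (l * X (\<omega> i))\<^sup>2 / 2)"
  shows "integrable (Pi\<^sub>M {..<m} (\<lambda>_. N)) Z"
    and "(\<integral>\<omega>. Z \<omega> \<partial>Pi\<^sub>M {..<m} (\<lambda>_. N)) \<le> exp (real m * (l\<^sup>2 * q / 2))"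
proof -
  interpret N: prob_space N by fact
  interpret PN: product_sigma_finite "\<lambda>_::nat. N" by unfold_locales
  let ?f = "\<lambda>x. exp (l * X x - (l * X x)\<^sup>2 / 2)"
  have int: "integrable N ?f"
  proof (rule N.integrable_const_bound[where B = "exp (1 / 2)"])
    \<comment> \<open>This is the square of \<open>t - 1\<close> being non-negative.\<close>
    have "t - t\<^sup>2 / 2 \<le> 1 / 2" for t :: real
      using sum_squares_bound[of t 1] by simp
    then show "AE x in N. norm (?f x) \<le> exp (1 / 2)" by simp
  qed simp
  have Z: "Z = (\<lambda>\<omega>. \<Prod>i<m. ?f (\<omega> i))"
    by (simp add: Z_def exp_sum)
  show "integrable (Pi\<^sub>M {..<m} (\<lambda>_. N)) Z"
    unfolding Z using int by (intro PN.product_integrable_prod) auto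
  have "(\<integral>x. ?f x \<partial>N) \<le> (\<integral>x. 1 + l * X x + l\<^sup>2 / 2 * (X x)\<^sup>2 \<partial>N)"
    using int X X2 exp_minus_half_square_le[of "l * X _"]
    by (intro integral_mono) (auto simp: power_mult_distrib)
  also have "\<dots> = 1 + l\<^sup>2 / 2 * (\<integral>x. (X x)\<^sup>2 \<partial>N)"
    using X X2 by (simp add: N.prob_space)
  also have "\<dots> \<le> 1 + l\<^sup>2 / 2 * q"
    using X2 by (intro add_left_mono mult_left_mono) auto
  also have "\<dots> \<le> exp (l\<^sup>2 * q / 2)"
    using exp_ge_add_one_self[of "l\<^sup>2 * q / 2"] by simp
  finally have le: "(\<integral>x. ?f x \<partial>N) \<le> exp (l\<^sup>2 * q / 2)" .
  have "(\<integral>\<omega>. Z \<omega> \<partial>Pi\<^sub>M {..<m} (\<lambda>_. N)) = (\<integral>x. ?f x \<partial>N) ^ m"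
    unfolding Z using int by (subst PN.product_integral_prod) auto
  also have "\<dots> \<le> exp (l\<^sup>2 * q / 2) ^ m"
    using le by (intro power_mono) auto
  also have "\<dots> = exp (real m * (l\<^sup>2 * q / 2))"
    by (simp only: exp_of_nat_mult)
  finally show "(\<integral>\<omega>. Z \<omega> \<partial>Pi\<^sub>M {..<m} (\<lambda>_. N)) \<le> exp (real m * (l\<^sup>2 * q / 2))" .
qed

text \<open>A finite maximal inequality of sub-Gaussian order in \<open>card T\<close>, under a
  square integrable envelope \<open>B\<close> only. The exponential of
  \<open>l * H - l^2 * V\<close>, with \<open>V\<close> a common bound for the normalizing terms, is
  dominated by a sum of self-normalized exponentials over all \<open>t\<close> and both signs. Since
  \<open>V\<close> has mean at most \<open>5 / 2 * m * b^2\<close>, the optimal \<open>l\<close>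
  gives \<open>2 * sqrt (5 / 2 * m * ln K) * b\<close>, which is the stated bound.\<close>

lemma expectation_Max_abs_sum_le:
  fixes g :: "'t \<Rightarrow> 'a \<Rightarrow> real" and m :: nat
  assumes N: "prob_space N" and T: "finite T" "T \<noteq> {}" and "m > 0" "b > 0"
    and g [measurable]: "\<And>t. t \<in> T \<Longrightarrow> g t \<in> borel_measurable N"
    and gB: "\<And>t x. t \<in> T \<Longrightarrow> x \<in> space N \<Longrightarrow> \<bar>g t x\<bar> \<le> B x"
    and B [measurable]: "B \<in> borel_measurable N"
    and B2: "integrable N (\<lambda>x. (B x)\<^sup>2)" "(\<integral>x. (B x)\<^sup>2 \<partial>N) \<le> b\<^sup>2"
  defines "H \<equiv> \<lambda>\<omega>. Max ((\<lambda>t. \<bar>\<Sum>i<m. g t (\<omega> i) - (\<integral>x. g t x \<partial>N)\<bar>) ` T)"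
  shows "integrable (Pi\<^sub>M {..<m} (\<lambda>_. N)) H"
    and "(\<integral>\<omega>. H \<omega> \<partial>Pi\<^sub>M {..<m} (\<lambda>_. N)) \<le> sqrt (10 * real m * ln (2 * real (card T))) * b"
proof -
  interpret N: prob_space N by fact
  let ?P = "Pi\<^sub>M {..<m} (\<lambda>_. N)"
  interpret P: prob_space ?P by (rule prob_space_PiM) (rule N)
  define X where "X t x = g t x - (\<integral>x. g t x \<partial>N)" for t x
  define Y where "Y t \<omega> = (\<Sum>i<m. X t (\<omega> i))" for t \<omega>
  have [measurable]: "X t \<in> borel_measurable N" if "t \<in> T" for t
    unfolding X_def[abs_def] using g[OF that] by measurable
  have g2_int: "integrable N (\<lambda>x. (g t x)\<^sup>2)" and g2_le: "(\<integral>x. (g t x)\<^sup>2 \<partial>N) \<le> b\<^sup>2" if t: "t \<in> T" for t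
  proof -
    have le: "(g t x)\<^sup>2 \<le> (B x)\<^sup>2" if "x \<in> space N" for x
      using gB[OF t that] by (simp add: abs_le_square_iff[symmetric])
    show i: "integrable N (\<lambda>x. (g t x)\<^sup>2)"
      using t le by (intro Bochner_Integration.integrable_bound[OF B2(1)]) auto
    have "(\<integral>x. (g t x)\<^sup>2 \<partial>N) \<le> (\<integral>x. (B x)\<^sup>2 \<partial>N)"
      using i B2(1) le by (rule integral_mono)
    then show "(\<integral>x. (g t x)\<^sup>2 \<partial>N) \<le> b\<^sup>2" using B2(2) by simp
  qed
  have g_int: "integrable N (g t)" if "t \<in> T" for t
    using g2_int[OF that] g[OF that] by (rule N.square_integrable_imp_integrable[rotated])
  have X_int: "integrable N (X t)" and X0: "(\<integral>x. X t x \<partial>N) = 0" if "t \<in> T" for t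
    using g_int[OF that] by (simp_all add: X_def[abs_def] N.prob_space)
  have X2_eq: "(X t x)\<^sup>2 = (g t x)\<^sup>2 - 2 * (\<integral>x. g t x \<partial>N) * g t x + (\<integral>x. g t x \<partial>N)\<^sup>2" for t x
    by (simp add: X_def power2_diff)
  have X2_int: "integrable N (\<lambda>x. (X t x)\<^sup>2)" if "t \<in> T" for t
    unfolding X2_eq using g_int[OF that] g2_int[OF that] by simp
  have var: "(\<integral>x. (X t x)\<^sup>2 \<partial>N) = (\<integral>x. (g t x)\<^sup>2 \<partial>N) - (\<integral>x. g t x \<partial>N)\<^sup>2" if "t \<in> T" for t
    unfolding X2_eq using g_int[OF that] g2_int[OF that] by (simp add: N.prob_space power2_eq_square)
  have X2_le: "(\<integral>x. (X t x)\<^sup>2 \<partial>N) \<le> b\<^sup>2" if "t \<in> T" for t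
    using var[OF that] g2_le[OF that] by (smt (verit) zero_le_power2)
  have mean2_le: "(\<integral>x. g t x \<partial>N)\<^sup>2 \<le> b\<^sup>2" if "t \<in> T" for t
  proof -
    have "0 \<le> (\<integral>x. (X t x)\<^sup>2 \<partial>N)" by simp
    then show ?thesis using var[OF that] g2_le[OF that] by linarith
  qed
  have H: "H = (\<lambda>\<omega>. Max ((\<lambda>t. \<bar>Y t \<omega>\<bar>) ` T))"
    by (simp add: H_def Y_def X_def)
  have Y_int: "integrable ?P (Y t)" if "t \<in> T" for t
    unfolding Y_def using X_int[OF that] that
    by (intro Bochner_Integration.integrable_sum integral_PiM_component(2) N) auto
  have Ym [measurable]: "Y t \<in> borel_measurable ?P" if "t \<in> T" for t
    using Y_int[OF that] by simp
  have H_ex: "\<exists>t\<in>T. H \<omega> = \<bar>Y t \<omega>\<bar>" for \<omega>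
  proof -
    have "H \<omega> \<in> (\<lambda>t. \<bar>Y t \<omega>\<bar>) ` T"
      unfolding H using T by (intro Max_in) auto
    then show ?thesis by (rule imageE) blast
  qed
  have Hm [measurable]: "H \<in> borel_measurable ?P"
    unfolding H using T by (intro borel_measurable_Max borel_measurable_abs Ym)
  show H_int: "integrable ?P H"
  proof (rule Bochner_Integration.integrable_bound)
    show "integrable ?P (\<lambda>\<omega>. \<Sum>t\<in>T. \<bar>Y t \<omega>\<bar>)"
      using Y_int by auto
    show "AE \<omega> in ?P. norm (H \<omega>) \<le> norm (\<Sum>t\<in>T. \<bar>Y t \<omega>\<bar>)"
    proof (intro AE_I2)
      fix \<omega>
      obtain t where t: "t \<in> T" "H \<omega> = \<bar>Y t \<omega>\<bar>" using H_ex by blast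
      have "\<bar>Y t \<omega>\<bar> \<le> (\<Sum>t\<in>T. \<bar>Y t \<omega>\<bar>)"
        using T(1) t(1) by (intro member_le_sum) auto
      then show "norm (H \<omega>) \<le> norm (\<Sum>t\<in>T. \<bar>Y t \<omega>\<bar>)" using t by simp
    qed
  qed simp
  \<comment> \<open>\<open>V\<close> dominates the self-normalizing terms of all \<open>t\<close> at once, so that a single exponential
    moment controls the maximum.\<close>
  define V where "V \<omega> = (\<Sum>i<m. (B (\<omega> i))\<^sup>2) + 3 / 2 * real m * b\<^sup>2" for \<omega>
  have V_int: "integrable ?P V"
    unfolding V_def using B2(1)
    by (intro Bochner_Integration.integrable_add Bochner_Integration.integrable_sum
      integral_PiM_component(2)[of N _ _ "\<lambda>x. (B x)\<^sup>2"] N) auto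
  have V_le: "(\<integral>\<omega>. V \<omega> \<partial>?P) \<le> 5 / 2 * real m * b\<^sup>2"
  proof -
    have "(\<integral>\<omega>. V \<omega> \<partial>?P) = (\<Sum>i<m. (\<integral>\<omega>. (B (\<omega> i))\<^sup>2 \<partial>?P)) + 3 / 2 * real m * b\<^sup>2"
      unfolding V_def using B2(1) integral_PiM_component(2)[of N _ "{..<m}" "\<lambda>x. (B x)\<^sup>2", OF N]
      by (subst Bochner_Integration.integral_add) (auto simp: P.prob_space)
    also have "\<dots> = real m * (\<integral>x. (B x)\<^sup>2 \<partial>N) + 3 / 2 * real m * b\<^sup>2"
      using integral_PiM_component(1)[of N _ "{..<m}" "\<lambda>x. (B x)\<^sup>2", OF N] by simp
    also have "\<dots> \<le> real m * b\<^sup>2 + 3 / 2 * real m * b\<^sup>2"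
      using B2(2) by (intro add_right_mono mult_left_mono) auto
    finally show ?thesis by simp
  qed
  \<comment> \<open>The constant 3/2 in \<open>V\<close> arises here: half the square of
    \<open>X t\<close> is at most the square of \<open>g t\<close> plus that of its mean, the latter
    is at most \<open>b^2\<close> because variances are non-negative, and a further
    \<open>b^2 / 2\<close> is reserved for the factor \<open>r\<close>.\<close>
  have V_ge: "(\<Sum>i<m. (X t (\<omega> i))\<^sup>2) / 2 + real m * b\<^sup>2 / 2 \<le> V \<omega>" if t: "t \<in> T" and w: "\<omega> \<in> space ?P" for t \<omega>
  proof -
    have "(X t (\<omega> i))\<^sup>2 / 2 + b\<^sup>2 / 2 \<le> (B (\<omega> i))\<^sup>2 + 3 / 2 * b\<^sup>2" if "i < m" for i
    proof -
      let ?c = "\<integral>x. g t x \<partial>N"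
      have "\<omega> i \<in> space N" using w that by (auto simp: space_PiM)
      then have "\<bar>g t (\<omega> i)\<bar> \<le> \<bar>B (\<omega> i)\<bar>"
        using gB[OF t, of "\<omega> i"] by simp
      then have "(g t (\<omega> i))\<^sup>2 \<le> (B (\<omega> i))\<^sup>2"
        by (simp only: abs_le_square_iff)
      moreover have "(X t (\<omega> i))\<^sup>2 \<le> 2 * (g t (\<omega> i))\<^sup>2 + 2 * ?c\<^sup>2"
        using sum_squares_bound[of "g t (\<omega> i)" "- ?c"] by (simp add: X2_eq algebra_simps)
      ultimately show ?thesis using mean2_le[OF t] by linarith
    qed
    then have "(\<Sum>i<m. (X t (\<omega> i))\<^sup>2 / 2 + b\<^sup>2 / 2) \<le> (\<Sum>i<m. (B (\<omega> i))\<^sup>2 + 3 / 2 * b\<^sup>2)"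
      by (intro sum_mono) simp
    then show ?thesis by (simp add: V_def sum.distrib sum_divide_distrib)
  qed
  \<comment> \<open>Counts the pairs of an index and a sign. Being at least 2 even for a singleton
    \<open>T\<close>, it keeps \<open>ln K\<close> and hence \<open>l\<close> positive.\<close>
  define K where "K = 2 * real (card T)"
  have "card T \<ge> 1" using T by (simp add: Suc_le_eq card_gt_0_iff)
  then have K: "K \<ge> 2" by (simp add: K_def)
  then have lnK: "ln K > 0" by simp
  \<comment> \<open>the minimizer of \<open>ln K / l + l * (5 / 2 * real m * b\<^sup>2)\<close>\<close>
  define l where "l = sqrt (ln K / (5 / 2 * real m)) / b"
  have l: "l > 0" using lnK \<open>m > 0\<close> \<open>b > 0\<close> by (simp add: l_def)
  \<comment> \<open>Here \<open>l\<close> is a parameter shadowing the fixed one, since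
    \<open>Z\<close> is needed at both \<open>l\<close> and \<open>- l\<close>.\<close>
  define Z where "Z l t \<omega> = exp (\<Sum>i<m. l * X t (\<omega> i) - (l * X t (\<omega> i))\<^sup>2 / 2)" for l t \<omega>
  have Z_int: "integrable ?P (Z l t)"
    and Z_le: "(\<integral>\<omega>. Z l t \<omega> \<partial>?P) \<le> exp (real m * (l\<^sup>2 * b\<^sup>2 / 2))" if "t \<in> T" for l t
    unfolding Z_def using self_normalized_mgf_le[OF N _ X_int X0 X2_int X2_le] that by auto
  \<comment> \<open>Each of the \<open>K\<close> exponentials has mean at most
    \<open>exp (m * l^2 * b^2 / 2)\<close>, so \<open>r\<close> times their sum has mean at most
    1.\<close>
  define r where "r = exp (- (real m * (l\<^sup>2 * b\<^sup>2 / 2))) / K"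
  have "K > 0" using K by simp
  have "r > 0" using \<open>K > 0\<close> by (simp add: r_def)
  have Z_eq: "Z s t \<omega> = exp (s * Y t \<omega> - s\<^sup>2 * ((\<Sum>i<m. (X t (\<omega> i))\<^sup>2) / 2))" for s t \<omega>
    by (simp add: Z_def Y_def sum_subtractf sum_distrib_left sum_divide_distrib power_mult_distrib)
  have pw: "1 + (l * H \<omega> - l\<^sup>2 * V \<omega> - ln K) \<le> r * (\<Sum>t\<in>T. Z l t \<omega> + Z (- l) t \<omega>)"
    if w: "\<omega> \<in> space ?P" for \<omega>
  proof -
    obtain t where t: "t \<in> T" "H \<omega> = \<bar>Y t \<omega>\<bar>" using H_ex by blast
    define s where "s = (if Y t \<omega> \<ge> 0 then l else - l)"
    have s: "l * \<bar>Y t \<omega>\<bar> = s * Y t \<omega>" "s\<^sup>2 = l\<^sup>2" by (auto simp: s_def)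
    have "1 + (l * H \<omega> - l\<^sup>2 * V \<omega> - ln K) \<le> exp (l * H \<omega> - l\<^sup>2 * V \<omega> - ln K)"
      by (rule exp_ge_add_one_self)
    also have "\<dots> = exp (s * Y t \<omega> - s\<^sup>2 * V \<omega>) / K"
      using \<open>K > 0\<close> by (simp add: exp_diff t s)
    \<comment> \<open>Replaces the common \<open>V\<close> by the normalizing term of this
      particular \<open>t\<close>; the reserved \<open>m * b^2 / 2\<close> becomes the exponential
      factor of \<open>r\<close>.\<close>
    also have "\<dots> \<le> exp (s * Y t \<omega> - s\<^sup>2 * ((\<Sum>i<m. (X t (\<omega> i))\<^sup>2) / 2 + real m * b\<^sup>2 / 2)) / K"
      using V_ge[OF t(1) w] \<open>K > 0\<close> by (intro divide_right_mono) (auto intro!: mult_left_mono)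
    also have "\<dots> = r * Z s t \<omega>"
    proof -
      have "s * Y t \<omega> - l\<^sup>2 * ((\<Sum>i<m. (X t (\<omega> i))\<^sup>2) / 2 + real m * b\<^sup>2 / 2)
        = - (real m * (l\<^sup>2 * b\<^sup>2 / 2)) + (s * Y t \<omega> - l\<^sup>2 * ((\<Sum>i<m. (X t (\<omega> i))\<^sup>2) / 2))"
        by (simp add: algebra_simps)
      then show ?thesis unfolding Z_eq r_def s(2) by (simp only: exp_add) simp
    qed
    also have "Z s t \<omega> \<le> Z l t \<omega> + Z (- l) t \<omega>"
      by (auto simp: s_def Z_def)
    also have "\<dots> \<le> (\<Sum>t\<in>T. Z l t \<omega> + Z (- l) t \<omega>)"
      using T(1) t(1) by (intro member_le_sum) (auto simp: Z_def)
    finally show ?thesis using \<open>r > 0\<close> by simp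
  qed
  \<comment> \<open>Bounding the exponential below by its tangent at 0 makes \<open>H\<close> and
    \<open>V\<close> enter linearly, so only the expectation of \<open>V\<close> is required. The
    two constants 1 cancel.\<close>
  have "1 + (l * (\<integral>\<omega>. H \<omega> \<partial>?P) - l\<^sup>2 * (\<integral>\<omega>. V \<omega> \<partial>?P) - ln K)
      = (\<integral>\<omega>. 1 + (l * H \<omega> - l\<^sup>2 * V \<omega> - ln K) \<partial>?P)"
    using H_int V_int by (simp add: P.prob_space)
  also have "\<dots> \<le> (\<integral>\<omega>. r * (\<Sum>t\<in>T. Z l t \<omega> + Z (- l) t \<omega>) \<partial>?P)"
    using H_int V_int Z_int by (intro integral_mono pw) auto
  also have "\<dots> = r * (\<Sum>t\<in>T. (\<integral>\<omega>. Z l t \<omega> \<partial>?P) + (\<integral>\<omega>. Z (- l) t \<omega> \<partial>?P))"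
    using Z_int by simp
  also have "\<dots> \<le> r * (\<Sum>t\<in>T. exp (real m * (l\<^sup>2 * b\<^sup>2 / 2)) + exp (real m * (l\<^sup>2 * b\<^sup>2 / 2)))"
    using Z_le[of _ l] Z_le[of _ "- l"] \<open>r > 0\<close>
    by (intro mult_left_mono sum_mono add_mono) auto
  also have "\<dots> = 1"
    using \<open>K > 0\<close> unfolding r_def by (simp add: K_def exp_minus field_simps)
  finally have "l * (\<integral>\<omega>. H \<omega> \<partial>?P) \<le> ln K + l\<^sup>2 * (\<integral>\<omega>. V \<omega> \<partial>?P)" by simp
  also have "\<dots> \<le> ln K + l\<^sup>2 * (5 / 2 * real m * b\<^sup>2)"
    using V_le by (intro add_left_mono mult_left_mono) auto
  also have "l\<^sup>2 * (5 / 2 * real m * b\<^sup>2) = ln K"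
    using lnK \<open>m > 0\<close> \<open>b > 0\<close> by (simp add: l_def power_divide real_sqrt_pow2)
  also have "ln K + ln K = l * (sqrt (10 * real m * ln K) * b)"
  proof -
    have "sqrt (ln K / (5 / 2 * real m)) * sqrt (10 * real m * ln K) = sqrt (4 * (ln K)\<^sup>2)"
      using \<open>m > 0\<close> by (simp add: real_sqrt_mult[symmetric] power2_eq_square)
    also have "\<dots> = 2 * ln K"
      using lnK by (simp add: real_sqrt_mult)
    finally show ?thesis using \<open>b > 0\<close> by (simp add: l_def)
  qed
  finally have "(\<integral>\<omega>. H \<omega> \<partial>?P) \<le> sqrt (10 * real m * ln K) * b"
    using l by simp
  then show "(\<integral>\<omega>. H \<omega> \<partial>?P) \<le> sqrt (10 * real m * ln (2 * real (card T))) * b"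
    by (simp add: K_def)
qed

subsection \<open>Chaining\<close>

lemma abs_cos_diff_le: "\<bar>cos x - cos y\<bar> \<le> \<bar>x - y\<bar>" for x y :: real
proof -
  have "\<bar>cos x - cos y\<bar> = 2 * \<bar>sin ((x + y) / 2)\<bar> * \<bar>sin ((y - x) / 2)\<bar>"
    by (simp add: cos_diff_cos abs_mult)
  also have "\<dots> \<le> 2 * 1 * \<bar>(y - x) / 2\<bar>"
    by (intro mult_mono abs_sin_x_le_abs_x) auto
  finally show ?thesis by simp
qed

lemma abs_cos_inner_diff_le: "\<bar>cos (w \<bullet> z) - cos (w \<bullet> u)\<bar> \<le> norm w * norm (z - u)"
  using abs_cos_diff_le[of "w \<bullet> z" "w \<bullet> u"] Cauchy_Schwarz_ineq2[of w "z - u"]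
  by (simp add: inner_diff_right)

text \<open>For the spectral measure this is \<open>m\<close> times the kernel error at the
  difference \<open>z = x - y\<close>. Depending on \<open>z\<close> alone, it allows chaining over
  a ball in the original space instead of over pairs.\<close>

definition cos_process :: "'a::euclidean_space measure \<Rightarrow> nat \<Rightarrow> (nat \<Rightarrow> 'a) \<Rightarrow> 'a \<Rightarrow> real" where
  "cos_process N m \<omega> z = (\<Sum>i<m. cos (\<omega> i \<bullet> z) - (\<integral>w. cos (w \<bullet> z) \<partial>N))"

text \<open>\<open>F\<close> stands for the scaled uniform error; asking only that it lie below
  every uniform bound of the process keeps the supremum over the ball out of the statement. The
  maximum over a coarse net is controlled by boundedness of the cosine, each refinement adds the
  maximum over the links to the previous net, and the distance from the nets to the whole ball
  disappears in the limit.\<close>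

lemma expectation_cos_process_bound:
  fixes N :: "'a::euclidean_space measure" and m :: nat and F :: "(nat \<Rightarrow> 'a) \<Rightarrow> real"
  assumes N: "prob_space N" and sets_N: "sets N = sets borel"
    and w2: "integrable N (\<lambda>w. (norm w)\<^sup>2)" and "m > 0" "D \<ge> 0"
    and F: "integrable (Pi\<^sub>M {..<m} (\<lambda>_. N)) F"
    and F_le: "\<And>\<omega> r. (\<And>z. z \<in> cball 0 D \<Longrightarrow> \<bar>cos_process N m \<omega> z\<bar> \<le> r) \<Longrightarrow> F \<omega> \<le> r"
  shows "(\<integral>\<omega>. F \<omega> \<partial>Pi\<^sub>M {..<m} (\<lambda>_. N)) \<le>
    7 * sqrt (10 * real m * real DIM('a) * (ln (2 * D + 1) + ln (spectral_sigma N + 1) + 1))"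
proof -
  interpret N: prob_space N by fact
  let ?P = "Pi\<^sub>M {..<m} (\<lambda>_. N)"
  interpret P: prob_space ?P by (rule prob_space_PiM) (rule N)
  note [measurable_cong] = sets_N
  define \<sigma> where "\<sigma> = spectral_sigma N"
  have \<sigma>0: "\<sigma> \<ge> 0" by (simp add: \<sigma>_def spectral_sigma_def)
  have \<sigma>2: "(\<integral>w. (norm w)\<^sup>2 \<partial>N) = \<sigma>\<^sup>2"
    by (simp add: \<sigma>_def spectral_sigma_def)
  \<comment> \<open>Chosen so that \<open>\<sigma> * \<delta> j\<close> is at most
    \<open>1 / 2 ^ j\<close>. Using \<open>\<sigma> + 1\<close> avoids division by zero and produces
    the term \<open>ln (\<sigma> + 1)\<close>.\<close>
  define \<delta> where "\<delta> j = 1 / ((\<sigma> + 1) * 2 ^ j)" for j :: nat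
  have \<delta>0: "\<delta> j > 0" for j using \<sigma>0 by (simp add: \<delta>_def)
  have "\<exists>T :: 'a set. finite T \<and> 0 \<in> T \<and> T \<subseteq> cball 0 D \<and> (\<forall>z\<in>cball 0 D. \<exists>u\<in>T. dist z u \<le> \<delta> j)
      \<and> real (card T) \<le> (1 + 2 * D / \<delta> j) ^ DIM('a)" for j
    by (rule finite_net_cball[OF \<open>D \<ge> 0\<close> \<delta>0[of j]]) blast
  then obtain T :: "nat \<Rightarrow> 'a set" where T: "\<And>j. finite (T j)" "\<And>j. 0 \<in> T j" "\<And>j. T j \<subseteq> cball 0 D"
      "\<And>j z. z \<in> cball 0 D \<Longrightarrow> \<exists>u\<in>T j. dist z u \<le> \<delta> j"
      "\<And>j. real (card (T j)) \<le> (1 + 2 * D / \<delta> j) ^ DIM('a)"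
    by metis
  have Tne: "T j \<noteq> {}" for j using T(2) by blast
  \<comment> \<open>The dimension times the first two summands bounds the logarithm of the size of
    the coarsest net. The summand 1 absorbs the \<open>ln 2\<close> from the two signs, as the
    dimension is at least 1, and guarantees \<open>A \<ge> 1\<close>.\<close>
  define A where "A = ln (2 * D + 1) + ln (\<sigma> + 1) + 1"
  have A1: "A \<ge> 1" using \<sigma>0 \<open>D \<ge> 0\<close> by (simp add: A_def)
  define C where "C = sqrt (10 * real m * real DIM('a) * A)"
  have C0: "C \<ge> 0" using A1 by (simp add: C_def)
  have ln_card: "ln (2 * real (card (T j))) \<le> (real j + 1)\<^sup>2 * (real DIM('a) * A)" for j
  proof -
    have "card (T j) > 0" using T(1) Tne by (simp add: card_gt_0_iff)
    then have c: "real (card (T j)) > 0" by simp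
    have "1 + 2 * D / \<delta> j = 1 + 2 * D * ((\<sigma> + 1) * 2 ^ j)"
      by (simp add: \<delta>_def)
    also have "\<dots> \<le> (2 * D + 1) * ((\<sigma> + 1) * 2 ^ j)"
    proof -
      have "1 * 1 \<le> (\<sigma> + 1) * 2 ^ j"
        using \<sigma>0 by (intro mult_mono) auto
      then show ?thesis by (simp add: algebra_simps)
    qed
    finally have "(1 + 2 * D / \<delta> j) ^ DIM('a) \<le> ((2 * D + 1) * ((\<sigma> + 1) * 2 ^ j)) ^ DIM('a)"
      using \<open>D \<ge> 0\<close> \<delta>0[of j] by (intro power_mono) auto
    with T(5)[of j] have "real (card (T j)) \<le> ((2 * D + 1) * ((\<sigma> + 1) * 2 ^ j)) ^ DIM('a)"
      by linarith
    then have "ln (real (card (T j))) \<le> ln (((2 * D + 1) * ((\<sigma> + 1) * 2 ^ j)) ^ DIM('a))"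
      using c by simp
    also have "\<dots> = real DIM('a) * (ln (2 * D + 1) + ln (\<sigma> + 1) + real j * ln 2)"
    proof -
      have pos: "2 * D + 1 > 0" "\<sigma> + 1 > 0" using \<sigma>0 \<open>D \<ge> 0\<close> by auto
      then have "ln ((2 * D + 1) * ((\<sigma> + 1) * 2 ^ j)) = ln (2 * D + 1) + ln (\<sigma> + 1) + real j * ln 2"
        by (simp add: ln_mult_pos ln_realpow)
      then show ?thesis using pos by (subst ln_realpow) auto
    qed
    also have "\<dots> \<le> real DIM('a) * (A - 1 + real j)"
      using ln_2_less_1 by (intro mult_left_mono) (auto simp: A_def mult_left_le)
    finally have "ln (2 * real (card (T j))) \<le> 1 + real DIM('a) * (A - 1 + real j)"
      using c ln_2_less_1 by (simp add: ln_mult)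
    also have "\<dots> \<le> real DIM('a) * 1 + real DIM('a) * (A - 1 + real j)"
      by (simp add: Suc_leI)
    also have "\<dots> = real DIM('a) * (A + real j * 1)" by (simp add: algebra_simps)
    \<comment> \<open>Generous, but it completes the square \<open>(j + 1)^2\<close>, so that the
      root grows only linearly in \<open>j\<close>.\<close>
    also have "\<dots> \<le> real DIM('a) * (A + ((real j)\<^sup>2 + 2 * real j) * A)"
    proof -
      have "real j * 1 \<le> ((real j)\<^sup>2 + 2 * real j) * A"
        using A1 by (intro mult_mono) auto
      then show ?thesis by (intro mult_left_mono) auto
    qed
    also have "\<dots> = (real j + 1)\<^sup>2 * (real DIM('a) * A)"
      by (simp add: power2_eq_square algebra_simps)
    finally show ?thesis .
  qed
  have sqrt_le: "sqrt (10 * real m * ln (2 * real (card (T j)))) \<le> C * (real j + 1)" for j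
  proof -
    have "10 * real m * ln (2 * real (card (T j))) \<le> 10 * real m * ((real j + 1)\<^sup>2 * (real DIM('a) * A))"
      by (intro mult_left_mono ln_card) auto
    also have "\<dots> = (10 * real m * real DIM('a) * A) * (real j + 1)\<^sup>2" by simp
    finally have "sqrt (10 * real m * ln (2 * real (card (T j))))
        \<le> sqrt ((10 * real m * real DIM('a) * A) * (real j + 1)\<^sup>2)"
      by (rule real_sqrt_le_mono)
    then show ?thesis unfolding C_def by (simp add: real_sqrt_mult)
  qed
  define G where "G = cos_process N m"
  define M where "M j \<omega> = Max ((\<lambda>t. \<bar>G \<omega> t\<bar>) ` T j)" for j \<omega>
  have cos_int: "integrable N (\<lambda>w. cos (w \<bullet> z))" for z
    by (rule N.integrable_const_bound[where B = 1]) auto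
  \<comment> \<open>At the coarsest level the envelope is the constant 1.\<close>
  have M0: "integrable ?P (M 0)" "(\<integral>\<omega>. M 0 \<omega> \<partial>?P) \<le> C"
  proof -
    have g: "(\<lambda>w. cos (w \<bullet> t)) \<in> borel_measurable N" for t by measurable
    have *: "integrable ?P (M 0)"
      "(\<integral>\<omega>. M 0 \<omega> \<partial>?P) \<le> sqrt (10 * real m * ln (2 * real (card (T 0)))) * 1"
      unfolding M_def G_def cos_process_def
      using expectation_Max_abs_sum_le[where B = "\<lambda>_. 1" and b = 1 and g = "\<lambda>t w. cos (w \<bullet> t)",
          OF N T(1) Tne \<open>m > 0\<close> zero_less_one g, of 0]
      by (simp_all add: N.prob_space)
    then show "integrable ?P (M 0)" "(\<integral>\<omega>. M 0 \<omega> \<partial>?P) \<le> C" using sqrt_le[of 0] by auto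
  qed
  \<comment> \<open>The link from a point of net \<open>j + 1\<close> to a point of net
    \<open>j\<close> within \<open>\<delta> j\<close>; the nets need not be nested.\<close>
  define \<pi> where "\<pi> j u = (SOME v. v \<in> T j \<and> dist u v \<le> \<delta> j)" for j u
  have \<pi>: "\<pi> j u \<in> T j \<and> dist u (\<pi> j u) \<le> \<delta> j" if "u \<in> T (Suc j)" for j u
    unfolding \<pi>_def by (rule someI_ex) (use T(3)[of "Suc j"] T(4)[of u j] that in blast)
  have M_ge: "\<bar>G \<omega> u\<bar> \<le> M j \<omega>" if "u \<in> T j" for j u \<omega>
    unfolding M_def using T(1) that by (intro Max_ge) auto
  define I where "I j \<omega> = Max ((\<lambda>u. \<bar>\<Sum>i<m. (cos (\<omega> i \<bullet> u) - cos (\<omega> i \<bullet> \<pi> j u))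
      - (\<integral>w. cos (w \<bullet> u) - cos (w \<bullet> \<pi> j u) \<partial>N)\<bar>) ` T (Suc j))" for j \<omega>
  have I_ge: "\<bar>G \<omega> u - G \<omega> (\<pi> j u)\<bar> \<le> I j \<omega>" if "u \<in> T (Suc j)" for j u \<omega>
  proof -
    have "G \<omega> u - G \<omega> (\<pi> j u) = (\<Sum>i<m. (cos (\<omega> i \<bullet> u) - cos (\<omega> i \<bullet> \<pi> j u))
      - (\<integral>w. cos (w \<bullet> u) - cos (w \<bullet> \<pi> j u) \<partial>N))"
      unfolding G_def cos_process_def sum_subtractf[symmetric]
      by (intro sum.cong) (auto simp: cos_int)
    then show ?thesis unfolding I_def using T(1) that by (simp add: Max_ge)
  qed
  have I: "integrable ?P (I j)" "(\<integral>\<omega>. I j \<omega> \<partial>?P) \<le> C * (real j + 2) / 2 ^ j" for j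
  proof -
    have g: "(\<lambda>w. cos (w \<bullet> u) - cos (w \<bullet> \<pi> j u)) \<in> borel_measurable N" for u by measurable
    have B: "\<bar>cos (w \<bullet> u) - cos (w \<bullet> \<pi> j u)\<bar> \<le> norm w * \<delta> j" if "u \<in> T (Suc j)" for u w
    proof -
      have "\<bar>cos (w \<bullet> u) - cos (w \<bullet> \<pi> j u)\<bar> \<le> norm w * norm (u - \<pi> j u)"
        by (rule abs_cos_inner_diff_le)
      also have "\<dots> \<le> norm w * \<delta> j"
        using \<pi>[OF that] by (intro mult_left_mono) (auto simp: dist_norm)
      finally show ?thesis .
    qed
    have Bm: "(\<lambda>w. norm w * \<delta> j) \<in> borel_measurable N" by measurable
    have B2: "integrable N (\<lambda>w. (norm w * \<delta> j)\<^sup>2)" using w2 by (simp add: power_mult_distrib)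
    have "(\<integral>w. (norm w * \<delta> j)\<^sup>2 \<partial>N) = (\<sigma> * \<delta> j)\<^sup>2"
      using \<sigma>2 by (simp add: power_mult_distrib)
    also have "\<dots> \<le> (1 / 2 ^ j)\<^sup>2"
      using \<sigma>0 by (intro power_mono) (auto simp: \<delta>_def divide_simps)
    finally have b2: "(\<integral>w. (norm w * \<delta> j)\<^sup>2 \<partial>N) \<le> (1 / 2 ^ j)\<^sup>2" .
    have b: "1 / 2 ^ j > (0 :: real)" by simp
    note * = expectation_Max_abs_sum_le[where g = "\<lambda>u w. cos (w \<bullet> u) - cos (w \<bullet> \<pi> j u)",
        OF N T(1) Tne \<open>m > 0\<close> b g B Bm B2 b2]
    show "integrable ?P (I j)" unfolding I_def using *(1) by simp
    have "(\<integral>\<omega>. I j \<omega> \<partial>?P) \<le> sqrt (10 * real m * ln (2 * real (card (T (Suc j))))) * (1 / 2 ^ j)"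
      unfolding I_def using *(2) by simp
    \<comment> \<open>The links are indexed by the finer net \<open>T (Suc j)\<close>, hence
      \<open>j + 2\<close> in the result, while their length is governed by the coarser scale
      \<open>\<delta> j\<close>.\<close>
    also have "\<dots> \<le> (C * (real (Suc j) + 1)) * (1 / 2 ^ j)"
      by (intro mult_right_mono sqrt_le) auto
    finally show "(\<integral>\<omega>. I j \<omega> \<partial>?P) \<le> C * (real j + 2) / 2 ^ j" by (simp add: add.commute)
  qed
  have M_Suc: "M (Suc j) \<omega> \<le> M j \<omega> + I j \<omega>" for j \<omega>
    unfolding M_def[of "Suc j"]
  proof (rule Max.boundedI)
    fix a assume "a \<in> (\<lambda>t. \<bar>G \<omega> t\<bar>) ` T (Suc j)"
    then obtain u where u: "u \<in> T (Suc j)" "a = \<bar>G \<omega> u\<bar>" by blast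
    then show "a \<le> M j \<omega> + I j \<omega>"
      using M_ge[of "\<pi> j u" j \<omega>] \<pi>[OF u(1)] I_ge[OF u(1), of \<omega>] by linarith
  qed (use T(1) Tne in auto)
  have Gm [measurable]: "(\<lambda>\<omega>. G \<omega> t) \<in> borel_measurable ?P" for t
    unfolding G_def cos_process_def by measurable
  have M_int: "integrable ?P (M j)" for j
  proof (induction j)
    case (Suc j)
    show ?case
    proof (rule Bochner_Integration.integrable_bound)
      show "integrable ?P (\<lambda>\<omega>. M j \<omega> + I j \<omega>)" using Suc I by auto
      show "M (Suc j) \<in> borel_measurable ?P"
        unfolding M_def using T(1) by (intro borel_measurable_Max) auto
      \<comment> \<open>Since every net contains 0, the maxima are non-negative and the one-sided
        recursion also bounds the norm.\<close>
      show "AE \<omega> in ?P. norm (M (Suc j) \<omega>) \<le> norm (M j \<omega> + I j \<omega>)"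
        using M_Suc M_ge[OF T(2)] by (intro AE_I2) (smt (verit) real_norm_def)
    qed
  qed (rule M0)
  \<comment> \<open>The closed form is \<open>1 + (\<Sum>j<n. (j + 2) / 2 ^ j)\<close>.\<close>
  have M_le: "(\<integral>\<omega>. M n \<omega> \<partial>?P) \<le> C * (7 - (2 * real n + 6) / 2 ^ n)" for n
  proof (induction n)
    case (Suc n)
    have "(\<integral>\<omega>. M (Suc n) \<omega> \<partial>?P) \<le> (\<integral>\<omega>. M n \<omega> + I n \<omega> \<partial>?P)"
      using M_int I M_Suc by (intro integral_mono) auto
    also have "\<dots> = (\<integral>\<omega>. M n \<omega> \<partial>?P) + (\<integral>\<omega>. I n \<omega> \<partial>?P)"
      using M_int I by simp
    also have "\<dots> \<le> C * (7 - (2 * real n + 6) / 2 ^ n) + C * (real n + 2) / 2 ^ n"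
      using Suc I(2)[of n] by (rule add_mono)
    also have "\<dots> = C * (7 - (2 * real (Suc n) + 6) / 2 ^ Suc n)"
      by (simp add: field_simps)
    finally show ?case .
  qed (use M0 in simp)
  define \<mu> where "\<mu> = (\<integral>w. norm w \<partial>N)"
  have norm_int: "integrable N norm"
    using w2 by (rule N.square_integrable_imp_integrable[rotated]) measurable
  \<comment> \<open>A random Lipschitz constant of the process. Its mean is finite and is only ever
    multiplied by \<open>\<delta> n\<close>, so it leaves no trace in the limit.\<close>
  define W where "W \<omega> = (\<Sum>i<m. norm (\<omega> i) + \<mu>)" for \<omega> :: "nat \<Rightarrow> 'a"
  have W_int: "integrable ?P W"
    unfolding W_def using norm_int
    by (intro Bochner_Integration.integrable_sum Bochner_Integration.integrable_add integral_PiM_component(2) N) auto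
  have osc: "\<bar>G \<omega> z - G \<omega> u\<bar> \<le> norm (z - u) * W \<omega>" for \<omega> z u
  proof -
    have "\<bar>(\<integral>w. cos (w \<bullet> z) \<partial>N) - (\<integral>w. cos (w \<bullet> u) \<partial>N)\<bar> = \<bar>\<integral>w. cos (w \<bullet> z) - cos (w \<bullet> u) \<partial>N\<bar>"
      by (simp add: cos_int)
    also have "\<dots> \<le> (\<integral>w. \<bar>cos (w \<bullet> z) - cos (w \<bullet> u)\<bar> \<partial>N)"
      by (rule integral_abs_bound)
    also have "\<dots> \<le> (\<integral>w. norm w * norm (z - u) \<partial>N)"
      using cos_int norm_int by (intro integral_mono abs_cos_inner_diff_le) auto
    also have "\<dots> = \<mu> * norm (z - u)" by (simp add: \<mu>_def)
    finally have E: "\<bar>(\<integral>w. cos (w \<bullet> z) \<partial>N) - (\<integral>w. cos (w \<bullet> u) \<partial>N)\<bar> \<le> \<mu> * norm (z - u)" .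
    have "\<bar>G \<omega> z - G \<omega> u\<bar> = \<bar>\<Sum>i<m. (cos (\<omega> i \<bullet> z) - cos (\<omega> i \<bullet> u)) -
        ((\<integral>w. cos (w \<bullet> z) \<partial>N) - (\<integral>w. cos (w \<bullet> u) \<partial>N))\<bar>"
      unfolding G_def cos_process_def sum_subtractf[symmetric]
      by (intro arg_cong[where f = abs] sum.cong) auto
    also have "\<dots> \<le> (\<Sum>i<m. \<bar>(cos (\<omega> i \<bullet> z) - cos (\<omega> i \<bullet> u)) -
        ((\<integral>w. cos (w \<bullet> z) \<partial>N) - (\<integral>w. cos (w \<bullet> u) \<partial>N))\<bar>)"
      by (rule sum_abs)
    also have "\<dots> \<le> (\<Sum>i<m. norm (z - u) * (norm (\<omega> i) + \<mu>))"
    proof (rule sum_mono)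
      fix i
      show "\<bar>(cos (\<omega> i \<bullet> z) - cos (\<omega> i \<bullet> u)) -
          ((\<integral>w. cos (w \<bullet> z) \<partial>N) - (\<integral>w. cos (w \<bullet> u) \<partial>N))\<bar> \<le> norm (z - u) * (norm (\<omega> i) + \<mu>)"
        using abs_cos_inner_diff_le[of "\<omega> i" z u] E by (simp add: algebra_simps)
    qed
    also have "\<dots> = norm (z - u) * W \<omega>" by (simp add: W_def sum_distrib_left)
    finally show ?thesis .
  qed
  have \<mu>0: "\<mu> \<ge> 0" by (simp add: \<mu>_def)
  have W0: "W \<omega> \<ge> 0" for \<omega> using \<mu>0 by (simp add: W_def sum_nonneg)
  have F_M: "F \<omega> \<le> M n \<omega> + \<delta> n * W \<omega>" for n \<omega>
  proof (rule F_le)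
    fix z :: 'a assume "z \<in> cball 0 D"
    then obtain u where u: "u \<in> T n" "dist z u \<le> \<delta> n" using T(4) by blast
    have "\<bar>G \<omega> z\<bar> \<le> \<bar>G \<omega> u\<bar> + norm (z - u) * W \<omega>" using osc[of \<omega> z u] by linarith
    also have "\<dots> \<le> M n \<omega> + \<delta> n * W \<omega>"
      using M_ge[OF u(1)] u(2) W0 by (intro add_mono mult_right_mono) (auto simp: dist_norm)
    finally show "\<bar>cos_process N m \<omega> z\<bar> \<le> M n \<omega> + \<delta> n * W \<omega>" by (simp add: G_def)
  qed
  have lim: "(\<integral>\<omega>. F \<omega> \<partial>?P) \<le> 7 * C + \<delta> n * (\<integral>\<omega>. W \<omega> \<partial>?P)" for n
  proof -
    have "(\<integral>\<omega>. F \<omega> \<partial>?P) \<le> (\<integral>\<omega>. M n \<omega> + \<delta> n * W \<omega> \<partial>?P)"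
      using F M_int W_int F_M by (intro integral_mono) auto
    also have "\<dots> = (\<integral>\<omega>. M n \<omega> \<partial>?P) + \<delta> n * (\<integral>\<omega>. W \<omega> \<partial>?P)"
      using M_int W_int by simp
    also have "(\<integral>\<omega>. M n \<omega> \<partial>?P) \<le> C * 7"
      by (rule order_trans[OF M_le mult_left_mono[OF _ C0]]) simp
    finally show ?thesis by simp
  qed
  have "(\<lambda>n. 7 * C + \<delta> n * (\<integral>\<omega>. W \<omega> \<partial>?P)) \<longlonglongrightarrow> 7 * C + 0 * (\<integral>\<omega>. W \<omega> \<partial>?P)"
  proof (intro tendsto_intros)
    have "(\<lambda>n. (1 / (\<sigma> + 1)) * (1 / 2) ^ n) \<longlonglongrightarrow> (1 / (\<sigma> + 1)) * 0"
      by (intro tendsto_intros LIMSEQ_power_zero) auto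
    then show "\<delta> \<longlonglongrightarrow> 0" unfolding \<delta>_def by (simp add: power_divide)
  qed
  then have "(\<integral>\<omega>. F \<omega> \<partial>?P) \<le> 7 * C + 0 * (\<integral>\<omega>. W \<omega> \<partial>?P)"
    by (rule LIMSEQ_le_const) (use lim in auto)
  then show ?thesis by (simp add: C_def A_def \<sigma>_def)
qed

subsection \<open>The uniform error\<close>

lemma sup_norm_on_least:
  assumes "S \<noteq> {}" "\<And>x y. x \<in> S \<Longrightarrow> y \<in> S \<Longrightarrow> \<bar>f x y\<bar> \<le> r"
  shows "sup_norm_on S f \<le> r"
  unfolding sup_norm_on_def using assms by (intro cSUP_least) auto

lemma sup_norm_on_upper:
  assumes "\<And>x y. x \<in> S \<Longrightarrow> y \<in> S \<Longrightarrow> \<bar>f x y\<bar> \<le> K" "x \<in> S" "y \<in> S"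
  shows "\<bar>f x y\<bar> \<le> sup_norm_on S f"
proof -
  have "(case (x, y) of (x, y) \<Rightarrow> \<bar>f x y\<bar>) \<le> sup_norm_on S f"
    unfolding sup_norm_on_def using assms
    by (intro cSUP_upper bdd_aboveI2[where M = K]) auto
  then show ?thesis by simp
qed

lemma sup_norm_on_diff_le:
  assumes "S \<noteq> {}"
    and "\<And>x y. x \<in> S \<Longrightarrow> y \<in> S \<Longrightarrow> \<bar>f x y\<bar> \<le> K" "\<And>x y. x \<in> S \<Longrightarrow> y \<in> S \<Longrightarrow> \<bar>g x y\<bar> \<le> K"
    and fg: "\<And>x y. x \<in> S \<Longrightarrow> y \<in> S \<Longrightarrow> \<bar>f x y - g x y\<bar> \<le> c"
  shows "\<bar>sup_norm_on S f - sup_norm_on S g\<bar> \<le> c"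
proof -
  have "sup_norm_on S f \<le> sup_norm_on S g + c"
  proof (rule sup_norm_on_least[OF assms(1)])
    fix x y assume "x \<in> S" "y \<in> S"
    then show "\<bar>f x y\<bar> \<le> sup_norm_on S g + c"
      using sup_norm_on_upper[of S g K x y, OF assms(3)] fg[of x y] by linarith
  qed
  moreover have "sup_norm_on S g \<le> sup_norm_on S f + c"
  proof (rule sup_norm_on_least[OF assms(1)])
    fix x y assume "x \<in> S" "y \<in> S"
    then show "\<bar>g x y\<bar> \<le> sup_norm_on S f + c"
      using sup_norm_on_upper[of S f K x y, OF assms(2)] fg[of x y] by linarith
  qed
  ultimately show ?thesis by linarith
qed

text \<open>By continuity the supremum over \<open>S \<times> S\<close> equals that over a countable
  dense subset, which is a supremum of countably many measurable functions.\<close>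

lemma borel_measurable_sup_norm_on:
  fixes f :: "'b \<Rightarrow> 'a::{metric_space, second_countable_topology} \<Rightarrow> 'a \<Rightarrow> real"
  assumes cont: "\<And>\<omega>. continuous_on UNIV (\<lambda>p. f \<omega> (fst p) (snd p))"
    and bdd: "\<And>\<omega> x y. \<bar>f \<omega> x y\<bar> \<le> K"
    and meas [measurable]: "\<And>x y. (\<lambda>\<omega>. f \<omega> x y) \<in> borel_measurable M"
  shows "(\<lambda>\<omega>. sup_norm_on S (f \<omega>)) \<in> borel_measurable M"
proof (cases "S = {}")
  case False
  obtain Q where Q: "countable Q" "Q \<subseteq> S \<times> S" "S \<times> S \<subseteq> closure Q"
    by (rule separable)
  have "Q \<noteq> {}" using Q(3) False by auto
  have bddQ: "bdd_above ((\<lambda>p. \<bar>f \<omega> (fst p) (snd p)\<bar>) ` Q)" for \<omega>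
    using bdd by (intro bdd_aboveI2)
  have eq: "sup_norm_on S (f \<omega>) = (SUP p\<in>Q. \<bar>f \<omega> (fst p) (snd p)\<bar>)" (is "_ = ?s") for \<omega>
  proof (rule antisym)
    have cl: "closed {p. \<bar>f \<omega> (fst p) (snd p)\<bar> \<le> ?s}"
      by (intro closed_Collect_le continuous_on_rabs cont continuous_on_const)
    have "Q \<subseteq> {p. \<bar>f \<omega> (fst p) (snd p)\<bar> \<le> ?s}"
      using bddQ by (auto intro: cSUP_upper)
    then have "closure Q \<subseteq> {p. \<bar>f \<omega> (fst p) (snd p)\<bar> \<le> ?s}"
      using cl by (rule closure_minimal)
    then have "\<bar>f \<omega> x y\<bar> \<le> ?s" if "x \<in> S" "y \<in> S" for x y
      using Q(3) that by fastforce
    then show "sup_norm_on S (f \<omega>) \<le> ?s"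
      using False by (rule sup_norm_on_least[rotated])
    show "?s \<le> sup_norm_on S (f \<omega>)"
      using \<open>Q \<noteq> {}\<close> Q(2) bdd by (intro cSUP_least sup_norm_on_upper[where K = K]) auto
  qed
  show ?thesis
    unfolding eq using Q(1) bddQ by (intro borel_measurable_cSUP) auto
qed (simp add: sup_norm_on_def)

lemma spectral_measure_cos:
  assumes "is_spectral_measure \<Lambda> \<psi>"
  shows "\<psi> z = (\<integral>w. cos (w \<bullet> z) \<partial>\<Lambda>)"
proof -
  interpret prob_space \<Lambda> using assms by (simp add: is_spectral_measure_def)
  have [measurable_cong]: "sets \<Lambda> = sets borel"
    using assms by (simp add: is_spectral_measure_def)
  have "integrable \<Lambda> (\<lambda>w. exp (\<i> * complex_of_real (w \<bullet> z)))"
    by (intro integrable_const_bound[where B = 1]) auto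
  then have "(\<integral>w. Re (exp (\<i> * complex_of_real (w \<bullet> z))) \<partial>\<Lambda>) = Re (complex_of_real (\<psi> z))"
    using assms by (simp add: is_spectral_measure_def)
  then show ?thesis by (simp add: Re_exp)
qed

text \<open>With \<open>a\<close> and \<open>b\<close> the roots of the two logarithms,
  \<open>rff_h\<close> is \<open>16 * sqrt (2 * d) * (2 * a + 2 * b + 1 / a)\<close>. After
  squaring, the claim compares \<open>490 = 49 * 10\<close> with
  \<open>512 = 2 * 16^2\<close>.\<close>

lemma chaining_constant_le_rff_h:
  assumes "D > 0" "s \<ge> 0" "m > 0"
  shows "ereal (7 * sqrt (10 * real m * real d * (ln (2 * D + 1) + ln (s + 1) + 1)))
    \<le> ereal (sqrt (real m)) * rff_h d D s"
proof -
  define a where "a = sqrt (ln (2 * D + 1))"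
  define b where "b = sqrt (ln (s + 1))"
  have L: "ln (2 * D + 1) > 0" using assms by simp
  have a: "a > 0" "ln (2 * D + 1) = a\<^sup>2" using L by (auto simp: a_def)
  have b: "b \<ge> 0" "ln (s + 1) = b\<^sup>2" using assms by (auto simp: b_def)
  have "7 * sqrt (10 * real m * real d * (a\<^sup>2 + b\<^sup>2 + 1)) = sqrt (490 * real m * real d * (a\<^sup>2 + b\<^sup>2 + 1))"
  proof -
    have "sqrt (490 * real m * real d * (a\<^sup>2 + b\<^sup>2 + 1)) = sqrt (7\<^sup>2 * (10 * real m * real d * (a\<^sup>2 + b\<^sup>2 + 1)))"
      by (rule arg_cong[where f = sqrt]) simp
    moreover have "\<bar>7 :: real\<bar> = 7" by simp
    ultimately show ?thesis by (simp only: real_sqrt_mult real_sqrt_abs)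
  qed
  also have "\<dots> \<le> sqrt (512 * real m * real d * (2 * a + 2 * b + 1 / a)\<^sup>2)"
  proof -
    \<comment> \<open>The last 4 is the cross term of \<open>2 * a\<close> and \<open>1 / a\<close>:
      the inverse logarithm in \<open>rff_h\<close> pays for the additive 1 of the chaining bound,
      however small the diameter.\<close>
    have "4 * a\<^sup>2 + 4 * b\<^sup>2 + 4 \<le> (2 * a + 2 * b + 1 / a)\<^sup>2"
    proof -
      have "(2 * a + 2 * b + 1 / a)\<^sup>2 = 4 * a\<^sup>2 + 4 * b\<^sup>2 + 4 + (8 * a * b + 4 * b / a + 1 / a\<^sup>2)"
        using a by (simp add: power2_eq_square field_simps)
      moreover have "8 * a * b + 4 * b / a + 1 / a\<^sup>2 \<ge> 0" using a b by simp
      ultimately show ?thesis by linarith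
    qed
    then have "490 * real m * real d * (a\<^sup>2 + b\<^sup>2 + 1) \<le> 512 * real m * real d * (2 * a + 2 * b + 1 / a)\<^sup>2"
      by (intro mult_mono) (auto intro: order_trans[OF _ \<open>4 * a\<^sup>2 + 4 * b\<^sup>2 + 4 \<le> _\<close>])
    then show ?thesis by (rule real_sqrt_le_mono)
  qed
  also have "\<dots> = sqrt (real m) * (16 * sqrt (2 * real d) * (2 * a + 2 * b + 1 / a))"
  proof -
    have "512 * real m * real d * (2 * a + 2 * b + 1 / a)\<^sup>2
        = real m * (2 * real d) * (16 * (2 * a + 2 * b + 1 / a))\<^sup>2"
      by (simp only: power_mult_distrib) simp
    moreover have "\<bar>16 * (2 * a + 2 * b + 1 / a)\<bar> = 16 * (2 * a + 2 * b + 1 / a)"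
      using a b by simp
    ultimately have "sqrt (512 * real m * real d * (2 * a + 2 * b + 1 / a)\<^sup>2)
        = sqrt (real m) * sqrt (2 * real d) * (16 * (2 * a + 2 * b + 1 / a))"
      by (simp only: real_sqrt_mult[of _ "_\<^sup>2"] real_sqrt_abs) (simp only: real_sqrt_mult[of "real m"])
    then show ?thesis by (simp only: mult.assoc mult.left_commute)
  qed
  also have "16 * sqrt (2 * real d) * (2 * a + 2 * b + 1 / a)
      = 32 * sqrt (2 * real d * ln (2 * D + 1)) + 32 * sqrt (2 * real d * ln (s + 1))
        + 16 * sqrt (2 * real d * inverse (ln (2 * D + 1)))"
    using a b by (simp add: real_sqrt_mult real_sqrt_inverse algebra_simps divide_inverse)
  finally show ?thesis
    using a b assms by (simp add: rff_h_def)
qed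

section \<open>Combining concentration around the mean with the bound on the mean\<close>

theorem theorem1:
  fixes \<psi> :: "real ^ 'd \<Rightarrow> real"
    and k :: "real ^ 'd \<Rightarrow> real ^ 'd \<Rightarrow> real"
    and \<Lambda> :: "(real ^ 'd) measure"
    and m :: nat
    and \<tau> :: real
    and S :: "(real ^ 'd) set"
  assumes "\<And>x y. k x y = \<psi> (x - y)"
    and "bounded (range \<psi>)"
    and "continuous_on UNIV \<psi>"
    and "positive_definite \<psi>"
    and "\<psi> 0 = 1"
    and "is_spectral_measure \<Lambda> \<psi>"
    and "integrable \<Lambda> (\<lambda>\<omega>. (norm \<omega>)\<^sup>2)"
    and "m \<ge> 1"
    and "\<tau> > 0"
    and "compact S"
    and "S \<noteq> {}"
  defines "P \<equiv> Pi\<^sub>M {..<m} (\<lambda>_. \<Lambda>)"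
  defines "A \<equiv> {\<omega> \<in> space P.
      ereal (sup_norm_on S (\<lambda>x y. rff_kernel m \<omega> x y - k x y))
        \<ge> (rff_h CARD('d) (diameter S) (spectral_sigma \<Lambda>) + ereal (sqrt (2 * \<tau>)))
           / ereal (sqrt (real m))}"
  shows "A \<in> sets P \<and> measure P A \<le> exp (- \<tau>)"
proof (cases "diameter S = 0")
  \<comment> \<open>The threshold is infinite here while the uniform error is a real number, so the
    event is empty.\<close>
  case True
  have "A = {}"
    using \<open>m \<ge> 1\<close> by (simp add: A_def True rff_h_def)
  then show ?thesis by simp
next
  case False
  have \<Lambda>: "prob_space \<Lambda>" and sets_\<Lambda>: "sets \<Lambda> = sets borel"
    using assms(6) by (auto simp: is_spectral_measure_def)
  interpret \<Lambda>: prob_space \<Lambda> by fact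
  interpret P: prob_space P unfolding P_def by (rule prob_space_PiM) (rule \<Lambda>)
  have m: "m > 0" using assms(8) by simp
  have D: "diameter S > 0"
    using False diameter_ge_0[OF compact_imp_bounded[OF \<open>compact S\<close>]] by simp
  note \<psi> = spectral_measure_cos[OF assms(6)]
  define f where "f \<omega> = sup_norm_on S (\<lambda>x y. rff_kernel m \<omega> x y - k x y)" for \<omega>
  have rff_bdd: "\<bar>rff_kernel m \<omega> x y\<bar> \<le> 1" for \<omega> and x y :: "real ^ 'd"
  proof -
    have "\<bar>\<Sum>i<m. cos (\<omega> i \<bullet> (x - y))\<bar> \<le> (\<Sum>i<m. 1)"
      by (rule order_trans[OF sum_abs sum_mono]) simp
    then show ?thesis using m by (simp add: rff_kernel_def abs_mult divide_simps)
  qed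
  note [measurable_cong] = sets_\<Lambda>
  have \<psi>_bdd: "\<bar>\<psi> z\<bar> \<le> 1" for z
  proof -
    have "\<bar>\<psi> z\<bar> \<le> (\<integral>w. \<bar>cos (w \<bullet> z)\<bar> \<partial>\<Lambda>)"
      unfolding \<psi> by (rule integral_abs_bound)
    also have "\<dots> \<le> 1"
      by (intro \<Lambda>.integral_le_const \<Lambda>.integrable_const_bound[where B = 1]) auto
    finally show ?thesis .
  qed
  have bdd: "\<bar>rff_kernel m \<omega> x y - k x y\<bar> \<le> 2" for \<omega> x y
    using abs_triangle_ineq4[of "rff_kernel m \<omega> x y" "k x y"] rff_bdd[of \<omega> x y] \<psi>_bdd[of "x - y"]
    unfolding assms(1) by linarith
  have f_meas [measurable]: "f \<in> borel_measurable P"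
    unfolding f_def
  proof (rule borel_measurable_sup_norm_on[OF _ bdd])
    fix \<omega>
    have "continuous_on UNIV (\<lambda>p. \<psi> (fst p - snd p))"
      using assms(3) by (rule continuous_on_compose2) (auto intro!: continuous_intros)
    then show "continuous_on UNIV (\<lambda>p. rff_kernel m \<omega> (fst p) (snd p) - k (fst p) (snd p))"
      unfolding rff_kernel_def assms(1) by (intro continuous_intros)
  next
    fix x y
    show "(\<lambda>\<omega>. rff_kernel m \<omega> x y - k x y) \<in> borel_measurable P"
      unfolding rff_kernel_def P_def by measurable
  qed
  have f_bdd: "\<bar>f \<omega>\<bar> \<le> 2" for \<omega>
  proof -
    obtain x where x: "x \<in> S" using \<open>S \<noteq> {}\<close> by blast
    then have "0 \<le> f \<omega>"
      unfolding f_def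
      using sup_norm_on_upper[where f = "\<lambda>x y. rff_kernel m \<omega> x y - k x y", OF bdd x x] by linarith
    moreover have "f \<omega> \<le> 2"
      unfolding f_def using \<open>S \<noteq> {}\<close> bdd by (rule sup_norm_on_least)
    ultimately show ?thesis by simp
  qed
  have f_diff: "\<bar>f (v(i := y)) - f v\<bar> \<le> 2 / real m" if "i < m" for v i y
    unfolding f_def
  proof (rule sup_norm_on_diff_le[OF \<open>S \<noteq> {}\<close>, where K = 2])
    fix x x'
    show "\<bar>rff_kernel m (v(i := y)) x x' - k x x'\<bar> \<le> 2" "\<bar>rff_kernel m v x x' - k x x'\<bar> \<le> 2"
      by (rule bdd)+
    have "(rff_kernel m (v(i := y)) x x' - k x x') - (rff_kernel m v x x' - k x x')
        = (1 / real m) * (\<Sum>j<m. cos ((v(i := y)) j \<bullet> (x - x')) - cos (v j \<bullet> (x - x')))"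
      by (simp add: rff_kernel_def sum_subtractf right_diff_distrib)
    also have "(\<Sum>j<m. cos ((v(i := y)) j \<bullet> (x - x')) - cos (v j \<bullet> (x - x')))
        = (\<Sum>j<m. if j = i then cos (y \<bullet> (x - x')) - cos (v i \<bullet> (x - x')) else 0)"
      by (intro sum.cong) auto
    also have "\<dots> = cos (y \<bullet> (x - x')) - cos (v i \<bullet> (x - x'))"
      using that by simp
    finally have eq: "(rff_kernel m (v(i := y)) x x' - k x x') - (rff_kernel m v x x' - k x x')
        = (1 / real m) * (cos (y \<bullet> (x - x')) - cos (v i \<bullet> (x - x')))" .
    have "\<bar>cos (y \<bullet> (x - x')) - cos (v i \<bullet> (x - x'))\<bar> \<le> 1 + 1"
      by (rule order_trans[OF abs_triangle_ineq4 add_mono]) auto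
    then show "\<bar>(rff_kernel m (v(i := y)) x x' - k x x') - (rff_kernel m v x x' - k x x')\<bar> \<le> 2 / real m"
      unfolding eq using m by (simp add: abs_mult divide_right_mono)
  qed
  have f_int: "integrable P f"
    using f_bdd by (intro P.integrable_const_bound[where B = 2]) auto
  define h where "h = real_of_ereal (rff_h CARD('d) (diameter S) (spectral_sigma \<Lambda>))"
  have h: "rff_h CARD('d) (diameter S) (spectral_sigma \<Lambda>) = ereal h"
    using False by (simp add: h_def rff_h_def)
  have A_eq: "A = {\<omega> \<in> space P. f \<omega> \<ge> (h + sqrt (2 * \<tau>)) / sqrt (real m)}"
    using m by (simp add: A_def f_def h)
  \<comment> \<open>The chaining bound is applied to \<open>m * f\<close> with \<open>D\<close> the
    diameter of \<open>S\<close>, because differences of points of \<open>S\<close> lie in the ball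
    of that radius around 0.\<close>
  have Ef: "(\<integral>\<omega>. f \<omega> \<partial>P) \<le> h / sqrt (real m)"
  proof -
    have "(\<integral>\<omega>. real m * f \<omega> \<partial>P)
        \<le> 7 * sqrt (10 * real m * real DIM(real ^ 'd) * (ln (2 * diameter S + 1) + ln (spectral_sigma \<Lambda> + 1) + 1))"
      unfolding P_def
    proof (rule expectation_cos_process_bound[OF \<Lambda> sets_\<Lambda> assms(7) m less_imp_le[OF D]])
      show "integrable (Pi\<^sub>M {..<m} (\<lambda>_. \<Lambda>)) (\<lambda>\<omega>. real m * f \<omega>)"
        using f_int by (simp add: P_def)
      fix \<omega> r assume r: "\<And>z. z \<in> cball 0 (diameter S) \<Longrightarrow> \<bar>cos_process \<Lambda> m \<omega> z\<bar> \<le> r"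
      have "f \<omega> \<le> r / real m"
        unfolding f_def
      proof (rule sup_norm_on_least[OF \<open>S \<noteq> {}\<close>])
        fix x y assume "x \<in> S" "y \<in> S"
        then have "x - y \<in> cball 0 (diameter S)"
          using diameter_bounded_bound[OF compact_imp_bounded[OF \<open>compact S\<close>]] by (simp add: dist_norm)
        then have "\<bar>cos_process \<Lambda> m \<omega> (x - y)\<bar> \<le> r" by (rule r)
        moreover have "rff_kernel m \<omega> x y - k x y = cos_process \<Lambda> m \<omega> (x - y) / real m"
          using m by (simp add: rff_kernel_def cos_process_def assms(1) \<psi> sum_subtractf field_simps)
        ultimately show "\<bar>rff_kernel m \<omega> x y - k x y\<bar> \<le> r / real m"
          using m by (simp add: divide_right_mono)
      qed
      then show "real m * f \<omega> \<le> r" using m by (simp add: field_simps)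
    qed
    also have "\<dots> \<le> sqrt (real m) * h"
    proof -
      have "spectral_sigma \<Lambda> \<ge> 0" by (simp add: spectral_sigma_def)
      then show ?thesis
        using chaining_constant_le_rff_h[OF D _ m, of "spectral_sigma \<Lambda>" "CARD('d)"] by (simp add: h)
    qed
    finally have "sqrt (real m) * (sqrt (real m) * (\<integral>\<omega>. f \<omega> \<partial>P)) \<le> sqrt (real m) * h"
      by (simp flip: mult.assoc)
    then have "sqrt (real m) * (\<integral>\<omega>. f \<omega> \<partial>P) \<le> h"
      using m by (simp only: mult_le_cancel_left_pos real_sqrt_gt_zero of_nat_0_less_iff)
    then show ?thesis using m by (simp add: pos_le_divide_eq mult.commute)
  qed
  \<comment> \<open>With differences \<open>2 / m\<close>, the exponent in McDiarmid's inequality is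
    \<open>s^2 * m / 2\<close>, which equals \<open>\<tau>\<close> for this
    \<open>s\<close>.\<close>
  define s where "s = sqrt (2 * \<tau>) / sqrt (real m)"
  have s: "s > 0" using m \<open>\<tau> > 0\<close> by (simp add: s_def)
  \<comment> \<open>The threshold in \<open>A\<close> is \<open>h / sqrt m + s\<close>, hence at
    least the mean of \<open>f\<close> plus \<open>s\<close>.\<close>
  have "measure P A \<le> measure P {\<omega> \<in> space P. f \<omega> \<ge> (\<integral>\<omega>. f \<omega> \<partial>P) + s}"
    using Ef by (intro P.finite_measure_mono) (auto simp: A_eq s_def add_divide_distrib)
  also have "\<dots> \<le> exp (- 2 * s\<^sup>2 / (real m * (2 / real m)\<^sup>2))"
    unfolding P_def using f_bdd f_diff f_meas m s unfolding P_def
    by (intro mcdiarmid[OF \<Lambda>]) auto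
  also have "\<dots> = exp (- \<tau>)"
    using m \<open>\<tau> > 0\<close> by (simp add: s_def power_divide field_simps power2_eq_square)
  finally show ?thesis by (simp add: A_eq)
qed

end
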